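(* Let $\Psi=\{\overline{\psi_\vartheta(-1)}\,\psi_\vartheta:\ \vartheta\in\widehat{\Theta}\}$. Then $H^\infty(\mathcal{K}_\Psi)=H^\infty_1(\mathbb{D})$ as sets, and $\|f\|_{H^\infty(\mathcal{K}_\Psi)}=\|f\|_{\infty}$ for every $f$ in this space.
   Context: $\widehat{\Theta}$ is the set of probability measures on the unit circle $\mathbb{T}$ of the following two kinds: (i) $\frac12(\delta_a+\delta_{-a})$ with $a\in\mathbb{T}$; (ii) $\lambda_1\delta_{w_1}+\lambda_2\delta_{w_2}+\lambda_3\delta_{w_3}$ with $w_1,w_2,w_3\in\mathbb{T}$ distinct, $0$ in the interior of the triangle with vertices $w_1,w_2,w_3$, and $(\lambda_1,\lambda_2,\lambda_3)$ the barycentric coordinates of $0$ with respect to these vertices. For $\vartheta\in\widehat\Theta$, $h_\vartheta(z)=\int_{\mathbb{T}}\frac{w+z}{w-z}\,d\vartheta(w)$ and $\psi_\vartheta=\frac{h_\vartheta-1}{h_\vartheta+1}$; $\psi_\vartheta$ is a Blaschke product of degree 2 or 3 with $\psi_\vartheta(0)=\psi_\vartheta'(0)=0$, so $|\psi_\vartheta(-1)|=1$ and $\Psi$ consists of such Blaschke products normalised to take the value $1$ at $-1$. $H^\infty_1(\mathbb{D})=\{g\in H^\infty(\mathbb{D}): g'(0)=0\}$ with the supremum norm. For a set $\Psi$ of functions on $\mathbb{D}$, $\mathcal{K}_\Psi$ is the set of positive semidefinite kernels $k:\mathbb{D}\times\mathbb{D}\to\mathbb{C}$ such that $(1-\psi(x)\overline{\psi(y)})k(x,y)$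 is a positive semidefinite kernel for every $\psi\in\Psi$. A function $f:\mathbb{D}\to\mathbb{C}$ lies in the closed unit ball of $H^\infty(\mathcal{K}_\Psi)$ iff $(1-f(x)\overline{f(y)})k(x,y)$ is positive semidefinite for every $k\in\mathcal{K}_\Psi$; $H^\infty(\mathcal{K}_\Psi)$ is the set of scalar multiples of such functions, with norm $\|f\|_{H^\infty(\mathcal{K}_\Psi)}=\inf\{t>0: f/t \text{ lies in this unit ball}\}$. *)

theory Defs
  imports "HOL-Analysis.Analysis"
begin

text \<open>The unit disc is ball 0 1; the unit circle is sphere 0 1.
  A finitely atomic measure on the circle is represented by its weight function
  (mass of each point); all measures in Theta-hat are of this kind.\<close>

definition theta_hat :: "(complex \<Rightarrow> real) set" where
  "theta_hat =
     {\<mu>. \<exists>a. a \<in> sphere 0 1 \<and> \<mu> = (\<lambda>w. if w = a \<or> w = - a then 1/2 else 0)}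
   \<union> {\<mu>. \<exists>w1 w2 w3 l1 l2 l3.
          w1 \<in> sphere 0 1 \<and> w2 \<in> sphere 0 1 \<and> w3 \<in> sphere 0 1 \<and>
          w1 \<noteq> w2 \<and> w1 \<noteq> w3 \<and> w2 \<noteq> w3 \<and>
          0 \<in> interior (convex hull {w1, w2, w3}) \<and>
          l1 + l2 + l3 = 1 \<and>
          of_real l1 * w1 + of_real l2 * w2 + of_real l3 * w3 = 0 \<and>
          \<mu> = (\<lambda>w. if w = w1 then l1 else if w = w2 then l2 else if w = w3 then l3 else 0)}"

definition herglotz :: "(complex \<Rightarrow> real) \<Rightarrow> complex \<Rightarrow> complex" where
  "herglotz \<mu> z = (\<Sum>w\<in>{w. \<mu> w \<noteq> 0}. of_real (\<mu> w) * ((w + z) / (w - z)))"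

definition psi_theta :: "(complex \<Rightarrow> real) \<Rightarrow> complex \<Rightarrow> complex" where
  "psi_theta \<mu> z = (herglotz \<mu> z - 1) / (herglotz \<mu> z + 1)"

text \<open>Value at -1 of the (continuously extended) Blaschke product psi_theta.\<close>
definition psi_at_minus1 :: "(complex \<Rightarrow> real) \<Rightarrow> complex" where
  "psi_at_minus1 \<mu> = Lim (at (-1) within ball 0 1) (psi_theta \<mu>)"

definition Psi_set :: "(complex \<Rightarrow> complex) set" where
  "Psi_set = {(\<lambda>z. cnj (psi_at_minus1 \<mu>) * psi_theta \<mu> z) | \<mu>. \<mu> \<in> theta_hat}"

definition psd_kernel :: "(complex \<Rightarrow> complex \<Rightarrow> complex) \<Rightarrow> bool" where
  "psd_kernel k \<longleftrightarrow>
     (\<forall>(n::nat) (x::nat \<Rightarrow> complex) (c::nat \<Rightarrow> complex).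
        (\<forall>i<n. x i \<in> ball 0 1) \<longrightarrow>
        Im (\<Sum>i<n. \<Sum>j<n. c i * cnj (c j) * k (x i) (x j)) = 0 \<and>
        Re (\<Sum>i<n. \<Sum>j<n. c i * cnj (c j) * k (x i) (x j)) \<ge> 0)"

definition K_Psi :: "(complex \<Rightarrow> complex) set \<Rightarrow> (complex \<Rightarrow> complex \<Rightarrow> complex) set" where
  "K_Psi \<Psi> = {k. psd_kernel k \<and>
       (\<forall>\<psi>\<in>\<Psi>. psd_kernel (\<lambda>x y. (1 - \<psi> x * cnj (\<psi> y)) * k x y))}"

definition Hinf_K_ball :: "(complex \<Rightarrow> complex) set \<Rightarrow> (complex \<Rightarrow> complex) set" where
  "Hinf_K_ball \<Psi> = {f. \<forall>k\<in>K_Psi \<Psi>. psd_kernel (\<lambda>x y. (1 - f x * cnj (f y)) * k x y)}"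

definition Hinf_K :: "(complex \<Rightarrow> complex) set \<Rightarrow> (complex \<Rightarrow> complex) set" where
  "Hinf_K \<Psi> = {f. \<exists>(t::complex) g. g \<in> Hinf_K_ball \<Psi> \<and> f = (\<lambda>z. t * g z)}"

definition Hinf_K_norm :: "(complex \<Rightarrow> complex) set \<Rightarrow> (complex \<Rightarrow> complex) \<Rightarrow> real" where
  "Hinf_K_norm \<Psi> f = Inf {t::real. t > 0 \<and> (\<lambda>z. f z / of_real t) \<in> Hinf_K_ball \<Psi>}"

definition Hinf_1 :: "(complex \<Rightarrow> complex) set" where
  "Hinf_1 = {f. f holomorphic_on ball 0 1 \<and> bounded (f ` ball 0 1) \<and> deriv f 0 = 0}"

definition sup_norm :: "(complex \<Rightarrow> complex) \<Rightarrow> real" where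
  "sup_norm f = (SUP z\<in>ball 0 1. norm (f z))"

end

theory Submission
  imports Defs "HOL-Complex_Analysis.Cauchy_Integral_Formula"
begin

text \<open>
  The Cayley transform turns \<open>1 - f x * cnj (f y)\<close> into \<open>h x + cnj (h y)\<close> up to a factor
  \<open>g x * cnj (g y)\<close>. If \<open>f'(0) = 0\<close>, the Herglotz measure of \<open>h\<close> is a limit of finitely atomic
  measures with barycentre \<open>0\<close>, and by Caratheodory's theorem each of these is a positive
  combination of elements of \<open>theta_hat\<close>; so \<open>f\<close> inherits positivity from the test functions.
  Conversely, the Szego kernel with its linear term removed is admissible, and contractivity with
  respect to this kernel forces \<open>f\<close> to be bounded by \<open>1\<close>, holomorphic, and without linear term.
\<close>

subsection \<open>Positive semidefinite kernels\<close>

text \<open>Positivity of \<open>(h x + cnj (h y)) * k x y\<close> is preserved under sums and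
  positive multiples of \<open>h\<close>, so it may be tested on generators of a cone;
  \<open>1 - f x * cnj (f y)\<close> has no such additivity in \<open>f\<close>. The obstacle in the
  approximation is that the barycentre must be exactly \<open>0\<close>, not merely close to it,
  before elements of \<open>theta_hat\<close> can be split off. Sampling the real part of a
  polynomial at roots of unity whose order exceeds the degree by at least two achieves this: the
  quadrature is exact on the low frequencies involved, and only the coefficient of \<open>z\<close>,
  which is zero, could move the barycentre. In the converse, \<open>f\<close> is an arbitrary
  function at the outset, so its regularity has to be read off from finitely many values at a time:
  divided differences of \<open>f\<close> are compared with those of the monomials other than
  \<open>z\<close>.\<close>

definition kernel_form ::
    "(complex \<Rightarrow> complex \<Rightarrow> complex) \<Rightarrow> nat \<Rightarrow> (nat \<Rightarrow> complex) \<Rightarrow> (nat \<Rightarrow> complex) \<Rightarrow> complex" where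
  "kernel_form k n x c = (\<Sum>i<n. \<Sum>j<n. c i * cnj (c j) * k (x i) (x j))"

lemma psd_kernel_iff:
  "psd_kernel k \<longleftrightarrow>
     (\<forall>n x c. (\<forall>i<n. x i \<in> ball 0 1) \<longrightarrow> kernel_form k n x c \<in> \<real>\<^sub>\<ge>\<^sub>0)"
  unfolding psd_kernel_def kernel_form_def complex_nonneg_Reals_iff by blast

lemma psd_kernelI:
  assumes "\<And>n x c. (\<And>i. i < n \<Longrightarrow> x i \<in> ball 0 1) \<Longrightarrow> kernel_form k n x c \<in> \<real>\<^sub>\<ge>\<^sub>0"
  shows "psd_kernel k"
  using assms unfolding psd_kernel_iff by blast

lemma psd_kernelD:
  assumes "psd_kernel k" "\<And>i. i < n \<Longrightarrow> x i \<in> ball 0 1"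
  shows "kernel_form k n x c \<in> \<real>\<^sub>\<ge>\<^sub>0"
  using assms unfolding psd_kernel_iff by blast

lemma kernel_form_cong:
  assumes "\<And>i. i < n \<Longrightarrow> x i \<in> ball 0 1"
    and "\<And>u v. u \<in> ball 0 1 \<Longrightarrow> v \<in> ball 0 1 \<Longrightarrow> k u v = k' u v"
  shows "kernel_form k n x c = kernel_form k' n x c"
  unfolding kernel_form_def using assms by (intro sum.cong) auto

lemma psd_kernel_cong:
  assumes "psd_kernel k'"
    and "\<And>u v. u \<in> ball 0 1 \<Longrightarrow> v \<in> ball 0 1 \<Longrightarrow> k u v = k' u v"
  shows "psd_kernel k"
proof (rule psd_kernelI)
  fix n :: nat and x c :: "nat \<Rightarrow> complex" assume x: "\<And>i. i < n \<Longrightarrow> x i \<in> ball (0::complex) 1"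
  show "kernel_form k n x c \<in> \<real>\<^sub>\<ge>\<^sub>0"
    using psd_kernelD[OF assms(1) x, where c = c] by (subst kernel_form_cong[OF x assms(2)])
qed

lemma psd_kernel_0: "psd_kernel (\<lambda>x y. 0)"
  by (rule psd_kernelI) (simp add: kernel_form_def)

lemma psd_kernel_add:
  assumes "psd_kernel k" "psd_kernel k'"
  shows "psd_kernel (\<lambda>x y. k x y + k' x y)"
proof (rule psd_kernelI)
  fix n :: nat and x c :: "nat \<Rightarrow> complex" assume x: "\<And>i. i < n \<Longrightarrow> x i \<in> ball (0::complex) 1"
  have "kernel_form (\<lambda>x y. k x y + k' x y) n x c = kernel_form k n x c + kernel_form k' n x c"
    by (simp add: kernel_form_def sum.distrib algebra_simps)
  then show "kernel_form (\<lambda>x y. k x y + k' x y) n x c \<in> \<real>\<^sub>\<ge>\<^sub>0"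
    using psd_kernelD[OF assms(1) x] psd_kernelD[OF assms(2) x] by simp
qed

lemma psd_kernel_sum:
  assumes "\<And>a. a \<in> A \<Longrightarrow> psd_kernel (k a)"
  shows "psd_kernel (\<lambda>x y. \<Sum>a\<in>A. k a x y)"
proof (cases "finite A")
  case True
  then show ?thesis using assms
    by (induction A rule: finite_induct) (simp_all add: psd_kernel_0 psd_kernel_add)
qed (simp add: psd_kernel_0)

lemma psd_kernel_conjugate:
  assumes "psd_kernel k"
  shows "psd_kernel (\<lambda>x y. g x * cnj (g y) * k x y)"
proof (rule psd_kernelI)
  fix n :: nat and x c :: "nat \<Rightarrow> complex" assume x: "\<And>i. i < n \<Longrightarrow> x i \<in> ball (0::complex) 1"
  have "kernel_form (\<lambda>x y. g x * cnj (g y) * k x y) n x c = kernel_form k n x (\<lambda>i. c i * g (x i))"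
    unfolding kernel_form_def by (intro sum.cong) (auto simp: mult_ac)
  then show "kernel_form (\<lambda>x y. g x * cnj (g y) * k x y) n x c \<in> \<real>\<^sub>\<ge>\<^sub>0"
    using psd_kernelD[OF assms(1) x] by simp
qed

lemma psd_kernel_scale:
  assumes "psd_kernel k" "0 \<le> t"
  shows "psd_kernel (\<lambda>x y. of_real t * k x y)"
proof -
  have "psd_kernel (\<lambda>x y. of_real (sqrt t) * cnj (of_real (sqrt t)) * k x y)"
    by (rule psd_kernel_conjugate[OF assms(1)])
  then show ?thesis
    using assms(2) by (simp flip: of_real_mult)
qed

lemma kernel_form_rank1:
  "kernel_form (\<lambda>x y. g x * cnj (g y)) n x c = of_real ((cmod (\<Sum>i<n. c i * g (x i)))\<^sup>2)"
  unfolding kernel_form_def complex_norm_square cnj_sum sum_product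
  by (intro sum.cong) (auto simp: mult_ac)

lemma psd_kernel_rank1: "psd_kernel (\<lambda>x y. g x * cnj (g y))"
  by (rule psd_kernelI) (simp add: kernel_form_rank1 flip: of_real_power)

lemma psd_kernel_limit:
  assumes "\<And>m. psd_kernel (K m)"
    and "\<And>u v. u \<in> ball 0 1 \<Longrightarrow> v \<in> ball 0 1 \<Longrightarrow> (\<lambda>m. K m u v) \<longlonglongrightarrow> k u v"
  shows "psd_kernel k"
proof (rule psd_kernelI)
  fix n :: nat and x c :: "nat \<Rightarrow> complex" assume x: "\<And>i. i < n \<Longrightarrow> x i \<in> ball (0::complex) 1"
  have "(\<lambda>m. kernel_form (K m) n x c) \<longlonglongrightarrow> kernel_form k n x c"
    unfolding kernel_form_def using x by (intro tendsto_intros assms(2)) auto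
  then show "kernel_form k n x c \<in> \<real>\<^sub>\<ge>\<^sub>0"
    by (rule Lim_in_closed_set[OF closed_nonneg_Reals_complex, rotated 2])
       (auto intro!: always_eventually psd_kernelD[OF assms(1)] x)
qed

lemma psd_kernel_diag:
  assumes "psd_kernel k" "u \<in> ball 0 1"
  shows "k u u \<in> \<real>\<^sub>\<ge>\<^sub>0"
  using psd_kernelD[OF assms(1), of 1 "\<lambda>_. u" "\<lambda>_. 1"] assms(2) by (simp add: kernel_form_def)

subsection \<open>Finitely supported measures on the circle\<close>

definition support :: "(complex \<Rightarrow> real) \<Rightarrow> complex set" where
  "support \<mu> = {w. \<mu> w \<noteq> 0}"

text \<open>The total mass is left free: the class has to contain the remainders of an induction
  that splits off multiples of elements of \<open>theta_hat\<close>, down to the zero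
  measure.\<close>

definition centered :: "(complex \<Rightarrow> real) \<Rightarrow> bool" where
  "centered \<mu> \<longleftrightarrow> finite (support \<mu>) \<and> support \<mu> \<subseteq> sphere 0 1 \<and> (\<forall>w. 0 \<le> \<mu> w) \<and>
     (\<Sum>w\<in>support \<mu>. of_real (\<mu> w) * w) = 0"

lemma sum_support_superset:
  assumes "finite S" "support \<mu> \<subseteq> S"
  shows "(\<Sum>w\<in>support \<mu>. of_real (\<mu> w) * (g w :: 'a :: real_algebra_1)) = (\<Sum>w\<in>S. of_real (\<mu> w) * g w)"
  using assms by (intro sum.mono_neutral_left) (auto simp: support_def)

text \<open>The difference of two coordinate vectors is an affine dependence, which the vertices of
  a nondegenerate triangle do not admit.\<close>

lemma barycentric_unique:
  fixes w1 w2 w3 :: complex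
  assumes "w1 \<noteq> w2" "w1 \<noteq> w3" "w2 \<noteq> w3" and int: "interior (convex hull {w1, w2, w3}) \<noteq> {}"
    and l: "l1 + l2 + l3 = (1::real)" "of_real l1 * w1 + of_real l2 * w2 + of_real l3 * w3 = p"
    and m: "m1 + m2 + m3 = (1::real)" "of_real m1 * w1 + of_real m2 * w2 + of_real m3 * w3 = p"
  shows "l1 = m1 \<and> l2 = m2 \<and> l3 = m3"
proof (rule ccontr)
  assume ne: "\<not> ?thesis"
  define U where "U = (\<lambda>v. if v = w1 then l1 - m1 else if v = w2 then l2 - m2 else l3 - m3)"
  have "\<not> affine_dependent {w1, w2, w3}"
    using interior_convex_hull_eq_empty[of "{w1, w2, w3}"] int assms(1-3) by simp
  moreover have "sum U {w1, w2, w3} = 0"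
    using assms(1-3) l(1) m(1) by (simp add: U_def)
  moreover have "\<exists>v\<in>{w1, w2, w3}. U v \<noteq> 0"
    using ne assms(1-3) by (auto simp: U_def)
  moreover have "(\<Sum>v\<in>{w1, w2, w3}. U v *\<^sub>R v) = 0"
    using assms(1-3) l(2) m(2) by (simp add: U_def scaleR_conv_of_real algebra_simps)
  ultimately show False
    by (subst (asm) affine_dependent_explicit_finite) auto
qed

text \<open>The weights of a triangle in \<open>theta_hat\<close> are given by linear equations
  alone; their sign comes from uniqueness of barycentric coordinates, by comparison with the
  nonnegative ones supplied by \<open>0 \<in> convex hull {w1, w2, w3}\<close>.\<close>

lemma theta_hat_centered:
  assumes "\<mu> \<in> theta_hat"
  shows "centered \<mu>" "sum \<mu> (support \<mu>) = 1"
proof -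
  have "centered \<mu> \<and> sum \<mu> (support \<mu>) = 1"
  proof (cases "\<exists>a. a \<in> sphere 0 1 \<and> \<mu> = (\<lambda>w. if w = a \<or> w = - a then 1/2 else 0)")
    case True
    then obtain a where a: "a \<in> sphere 0 1" "\<mu> = (\<lambda>w. if w = a \<or> w = - a then 1/2 else 0)"
      by blast
    have supp: "support \<mu> = {a, -a}"
      by (auto simp: support_def a(2))
    have "a \<noteq> -a" using a(1) by auto
    then show ?thesis
      unfolding centered_def supp using a by auto
  next
    case False
    then obtain w1 w2 w3 l1 l2 l3 where *:
      "w1 \<in> sphere 0 1" "w2 \<in> sphere 0 1" "w3 \<in> sphere 0 1"
      "w1 \<noteq> w2" "w1 \<noteq> w3" "w2 \<noteq> w3"
      "0 \<in> interior (convex hull {w1, w2, w3})"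
      "l1 + l2 + l3 = 1"
      "of_real l1 * w1 + of_real l2 * w2 + of_real l3 * w3 = 0"
      "\<mu> = (\<lambda>w. if w = w1 then l1 else if w = w2 then l2 else if w = w3 then l3 else 0)"
      using assms unfolding theta_hat_def by blast
    have "0 \<in> convex hull {w1, w2, w3}"
      using *(7) interior_subset by blast
    then obtain u v w where u: "0 \<le> u" "0 \<le> v" "0 \<le> w" "u + v + w = (1::real)"
        "u *\<^sub>R w1 + v *\<^sub>R w2 + w *\<^sub>R w3 = 0"
      unfolding convex_hull_3 by auto
    have "l1 = u \<and> l2 = v \<and> l3 = w"
      using * u by (intro barycentric_unique[of w1 w2 w3 l1 l2 l3 0]) (auto simp: scaleR_conv_of_real)
    then have nn: "0 \<le> l1" "0 \<le> l2" "0 \<le> l3" using u by auto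
    have sub: "support \<mu> \<subseteq> {w1, w2, w3}"
      by (auto simp: support_def *(10))
    have "(\<Sum>w\<in>support \<mu>. of_real (\<mu> w) * w) = (\<Sum>w\<in>{w1, w2, w3}. of_real (\<mu> w) * w)"
      by (rule sum_support_superset) (use sub in auto)
    also have "\<dots> = 0"
      using *(4-6,9) by (simp add: *(10) algebra_simps)
    finally have 1: "(\<Sum>w\<in>support \<mu>. of_real (\<mu> w) * w) = 0" .
    have "sum \<mu> (support \<mu>) = sum \<mu> {w1, w2, w3}"
      using sum_support_superset[of "{w1, w2, w3}" \<mu> "\<lambda>_. 1 :: real"] sub by simp
    also have "\<dots> = 1"
      using *(4-6,8) by (simp add: *(10) algebra_simps)
    finally show ?thesis
      unfolding centered_def using 1 sub *(1-3) nn finite_subset[OF sub] by (auto simp: *(10))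
  qed
  then show "centered \<mu>" "sum \<mu> (support \<mu>) = 1" by auto
qed

text \<open>A subset of least cardinality with \<open>0\<close> in its hull has at most three
  points, the plane being two-dimensional. Two points of the circle with \<open>0\<close> on their
  segment are antipodal; three points of a minimal set form a nondegenerate triangle with
  \<open>0\<close> in its interior.\<close>

lemma theta_hat_exists:
  assumes "S \<subseteq> sphere 0 1" "0 \<in> convex hull S"
  shows "\<exists>\<mu>\<in>theta_hat. support \<mu> \<subseteq> S"
proof -
  define P where "P = (\<lambda>T. finite T \<and> T \<subseteq> S \<and> 0 \<in> convex hull T)"
  have "\<exists>T. P T \<and> card T \<le> 3"
    using assms(2) unfolding P_def by (subst (asm) caratheodory) auto
  then obtain T0 where T0: "P T0" "card T0 \<le> 3" by blast
  obtain T where T: "P T" and min: "\<And>T'. P T' \<Longrightarrow> card T \<le> card T'"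
    using ex_has_least_nat[of P T0 card] T0 by blast
  have fin: "finite T" and TS: "T \<subseteq> S" and T0h: "0 \<in> convex hull T" using T by (auto simp: P_def)
  have noproper: "0 \<notin> convex hull T'" if "T' \<subset> T" for T'
  proof
    assume "0 \<in> convex hull T'"
    then have "P T'" using that T finite_subset by (auto simp: P_def)
    then show False using min[of T'] psubset_card_mono[OF fin that] by simp
  qed
  have "card T \<le> 3" using min[OF T0(1)] T0(2) by simp
  moreover have "card T \<noteq> 0" using T0h fin by auto
  moreover have "card T \<noteq> 1"
  proof
    assume "card T = 1"
    then obtain a where "T = {a}" using card_1_singletonE by blast
    then show False using T0h TS assms(1) by auto
  qed
  ultimately consider "card T = 2" | "card T = 3" by linarith
  then show ?thesis
  proof cases
    case 1
    then obtain a b where ab: "T = {a, b}" "a \<noteq> b" by (meson card_2_iff)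
    have "{a, b} \<subseteq> sphere 0 1" using TS assms(1) ab(1) by blast
    then have nab: "norm a = 1" "norm b = 1" by auto
    obtain u v where u: "0 \<le> u" "0 \<le> v" "u + v = 1" "u *\<^sub>R a + v *\<^sub>R b = 0"
      using T0h unfolding ab(1) convex_hull_2 by auto
    have "u *\<^sub>R a = - (v *\<^sub>R b)" using u(4) by (simp add: eq_neg_iff_add_eq_0)
    \<comment> \<open>Both points have modulus \<open>1\<close>, so the two weights agree.\<close>
    then have "norm (u *\<^sub>R a) = norm (v *\<^sub>R b)" by simp
    then have uv: "u = 1/2" "v = 1/2" using u nab by auto
    have "(1/2) *\<^sub>R (a + b) = 0" using u(4) unfolding uv scaleR_add_right .
    then have "b = -a" by (simp add: eq_neg_iff_add_eq_0 add.commute)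
    moreover have "(\<lambda>w. if w = a \<or> w = - a then 1/2 else 0) \<in> theta_hat"
      unfolding theta_hat_def using nab by auto
    ultimately show ?thesis
      using ab TS by (intro bexI[of _ "\<lambda>w. if w = a \<or> w = - a then 1/2 else 0"]) (auto simp: support_def)
  next
    case 2
    then obtain a b c where abc: "T = {a, b, c}" "a \<noteq> b" "a \<noteq> c" "b \<noteq> c"
      by (auto simp: card_3_iff)
    have "{a, b, c} \<subseteq> sphere 0 1" using TS assms(1) abc(1) by blast
    then have n: "norm a = 1" "norm b = 1" "norm c = 1" by auto
    have sub: "{a, b} \<subset> T" "{a, c} \<subset> T" "{b, c} \<subset> T" using abc by auto
    obtain u v w where u: "0 \<le> u" "0 \<le> v" "0 \<le> w" "u + v + w = 1"
        "u *\<^sub>R a + v *\<^sub>R b + w *\<^sub>R c = 0"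
      using T0h unfolding abc(1) convex_hull_3 by auto
    \<comment> \<open>A vanishing weight would place \<open>0\<close> on an edge, against
      minimality.\<close>
    have "u \<noteq> 0" "v \<noteq> 0" "w \<noteq> 0"
      using u noproper[OF sub(1)] noproper[OF sub(2)] noproper[OF sub(3)]
      unfolding convex_hull_2 by auto
    then have pos: "u > 0" "v > 0" "w > 0" using u by auto
    have hull: "convex hull {x, y, z} \<subseteq> convex hull {y, z}" if "between (y, z) x" for x y z :: complex
      using that unfolding between_mem_convex_hull
      by (metis convex_convex_hull empty_subsetI hull_minimal hull_subset insert_subset)
    \<comment> \<open>On a line one point lies between the other two, so the hull of all three is
      that of two, against minimality.\<close>
    have "\<not> collinear {a, b, c}"
    proof
      assume "collinear {a, b, c}"
      then consider "between (b, c) a" | "between (c, a) b" | "between (a, b) c"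
        unfolding collinear_between_cases by blast
      then show False
      proof cases
        case 1
        then show ?thesis using hull[OF 1] T0h noproper[OF sub(3)] abc(1) by auto
      next
        case 2
        then show ?thesis using hull[OF 2] T0h noproper[OF sub(2)] abc(1)
          by (auto simp: insert_commute)
      next
        case 3
        then show ?thesis using hull[OF 3] T0h noproper[OF sub(1)] abc(1)
          by (auto simp: insert_commute)
      qed
    qed
    then have int: "0 \<in> interior (convex hull {a, b, c})"
      using pos u by (subst interior_convex_hull_3_minimal) auto
    have "(\<lambda>x. if x = a then u else if x = b then v else if x = c then w else 0) \<in> theta_hat"
      unfolding theta_hat_def
      by (rule UnI2, rule CollectI, intro exI conjI)
         (use int abc n u in \<open>auto simp: scaleR_conv_of_real\<close>)
    then show ?thesis
      using abc TS
      by (intro bexI[of _ "\<lambda>x. if x = a then u else if x = b then v else if x = c then w else 0"])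
         (auto simp: support_def split: if_splits)
  qed
qed

section \<open>Herglotz transforms, the Cayley transform, and boundary values at
  \<open>-1\<close>\<close>

text \<open>The cross terms of the numerator cancel and \<open>w * cnj w = 1\<close> turns the rest
  into \<open>2 * (1 - x * cnj y)\<close>; a single atom thus contributes a rank-one kernel times
  the inverse of the Szego kernel.\<close>

lemma cayley_kernel:
  fixes w x y :: complex
  assumes "norm w = 1" "x \<noteq> w" "y \<noteq> w"
  shows "(w + x) / (w - x) + cnj ((w + y) / (w - y)) =
    2 * (1 - x * cnj y) * (1 / (w - x) * cnj (1 / (w - y)))"
proof -
  have w: "w * cnj w = 1" using assms(1) by (simp add: complex_norm_square[symmetric])
  have nz: "w - x \<noteq> 0" "cnj w - cnj y \<noteq> 0" using assms(2,3) by auto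
  have num: "(w + x) * (cnj w - cnj y) + (cnj w + cnj y) * (w - x) = 2 * (w * cnj w - x * cnj y)"
    by (simp add: algebra_simps)
  show ?thesis
    using nz num unfolding w by (simp add: add_frac_eq)
qed

lemma centered_finite: "centered \<mu> \<Longrightarrow> finite (support \<mu>)"
  and centered_sphere: "centered \<mu> \<Longrightarrow> w \<in> support \<mu> \<Longrightarrow> norm w = 1"
  and centered_nonneg: "centered \<mu> \<Longrightarrow> 0 \<le> \<mu> w"
  and centered_mean: "centered \<mu> \<Longrightarrow> (\<Sum>w\<in>support \<mu>. of_real (\<mu> w) * w) = 0"
  unfolding centered_def by auto

lemma herglotz_support:
  "herglotz \<mu> z = (\<Sum>w\<in>support \<mu>. of_real (\<mu> w) * ((w + z) / (w - z)))"
  by (simp add: herglotz_def support_def)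

lemma herglotz_kernel:
  assumes "centered \<mu>" "x \<notin> support \<mu>" "y \<notin> support \<mu>"
  shows "herglotz \<mu> x + cnj (herglotz \<mu> y) =
    2 * (1 - x * cnj y) * (\<Sum>w\<in>support \<mu>. of_real (\<mu> w) * (1 / (w - x) * cnj (1 / (w - y))))"
proof -
  have "herglotz \<mu> x + cnj (herglotz \<mu> y) =
     (\<Sum>w\<in>support \<mu>. of_real (\<mu> w) * ((w + x) / (w - x) + cnj ((w + y) / (w - y))))"
    by (simp add: herglotz_support algebra_simps sum.distrib)
  also have "\<dots> = (\<Sum>w\<in>support \<mu>. of_real (\<mu> w) * (2 * (1 - x * cnj y) * (1 / (w - x) * cnj (1 / (w - y)))))"
  proof (rule sum.cong[OF refl])
    fix w assume "w \<in> support \<mu>"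
    then show "of_real (\<mu> w) * ((w + x) / (w - x) + cnj ((w + y) / (w - y))) =
       of_real (\<mu> w) * (2 * (1 - x * cnj y) * (1 / (w - x) * cnj (1 / (w - y))))"
      using assms centered_sphere[OF assms(1)] by (subst cayley_kernel) auto
  qed
  also have "\<dots> = 2 * (1 - x * cnj y) * (\<Sum>w\<in>support \<mu>. of_real (\<mu> w) * (1 / (w - x) * cnj (1 / (w - y))))"
    by (simp only: sum_distrib_left mult_ac)
  finally show ?thesis .
qed

lemma ball_not_in_support: "centered \<mu> \<Longrightarrow> x \<in> ball 0 1 \<Longrightarrow> x \<notin> support \<mu>"
  using centered_sphere[of \<mu> x] by auto

lemma Re_herglotz:
  assumes "centered \<mu>" "x \<notin> support \<mu>"
  shows "Re (herglotz \<mu> x) = (1 - (norm x)\<^sup>2) * (\<Sum>w\<in>support \<mu>. \<mu> w / (norm (w - x))\<^sup>2)"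
proof -
  have "complex_of_real (2 * Re (herglotz \<mu> x)) = herglotz \<mu> x + cnj (herglotz \<mu> x)"
    by (simp add: complex_add_cnj)
  also have "\<dots> = of_real (2 * (1 - (norm x)\<^sup>2) * (\<Sum>w\<in>support \<mu>. \<mu> w / (norm (w - x))\<^sup>2))"
    unfolding herglotz_kernel[OF assms(1,2,2)] complex_norm_square[symmetric] norm_divide
    by (simp add: power_divide)
  finally show ?thesis unfolding of_real_eq_iff by (simp add: algebra_simps)
qed

lemma Re_herglotz_nonneg:
  assumes "centered \<mu>" "x \<in> ball 0 1"
  shows "0 \<le> Re (herglotz \<mu> x)"
  unfolding Re_herglotz[OF assms(1) ball_not_in_support[OF assms]]
  using assms by (intro mult_nonneg_nonneg sum_nonneg)
    (auto simp: abs_square_le_1 centered_nonneg power_le_one)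

lemma herglotz_plus_1_nonzero:
  assumes "centered \<mu>" "x \<in> ball 0 1"
  shows "herglotz \<mu> x + 1 \<noteq> 0"
proof
  assume "herglotz \<mu> x + 1 = 0"
  then have "Re (herglotz \<mu> x + 1) = 0" by simp
  then show False using Re_herglotz_nonneg[OF assms] by simp
qed

lemma cayley_transform_kernel:
  fixes a b :: complex
  assumes "a + 1 \<noteq> 0" "b + 1 \<noteq> 0"
  shows "(a + 1) * cnj (b + 1) * (1 - (a - 1) / (a + 1) * cnj ((b - 1) / (b + 1))) = 2 * (a + cnj b)"
proof -
  have "cnj (b + 1) \<noteq> 0" using assms(2) by (simp del: complex_cnj_add)
  then have "(a + 1) * cnj (b + 1) * (1 - (a - 1) / (a + 1) * (cnj (b - 1) / cnj (b + 1)))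
    = (a + 1) * cnj (b + 1) - (a - 1) * cnj (b - 1)"
    using assms(1) by (simp add: right_diff_distrib del: complex_cnj_add complex_cnj_diff)
  also have "\<dots> = 2 * (a + cnj b)" by (simp add: algebra_simps)
  finally show ?thesis by simp
qed

lemma nontrivial_at_minus1: "at (-1 :: complex) within ball 0 1 \<noteq> bot"
  by (simp add: trivial_limit_within islimpt_ball)

text \<open>If \<open>-1\<close> is not an atom, \<open>herglotz \<mu>\<close> is continuous and
  purely imaginary there, so numerator and denominator of \<open>psi_theta \<mu>\<close> have equal
  modulus. If it is an atom, \<open>herglotz \<mu>\<close> tends to infinity and
  \<open>psi_theta \<mu>\<close> to \<open>1\<close>.\<close>

lemma norm_psi_at_minus1:
  assumes "\<mu> \<in> theta_hat"
  shows "norm (psi_at_minus1 \<mu>) = 1"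
proof -
  let ?F = "at (-1 :: complex) within ball 0 1"
  note c = theta_hat_centered(1)[OF assms]
  have tend: "((\<lambda>z. \<Sum>w\<in>S. of_real (\<mu> w) * ((w + z) / (w - z))) \<longlongrightarrow>
       (\<Sum>w\<in>S. of_real (\<mu> w) * ((w + (-1)) / (w - (-1))))) ?F" if "-1 \<notin> S" for S
    using that by (intro tendsto_intros) (auto simp: eq_neg_iff_add_eq_0[symmetric])
  show ?thesis
  proof (cases "-1 \<in> support \<mu>")
    case False
    have lim: "(herglotz \<mu> \<longlongrightarrow> herglotz \<mu> (-1)) ?F"
      using tend[OF False] unfolding herglotz_support by simp
    have re: "Re (herglotz \<mu> (-1)) = 0"
      using Re_herglotz[OF c False] by simp
    have nz: "herglotz \<mu> (-1) + 1 \<noteq> 0"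
      using re by (auto simp: complex_eq_iff)
    have "psi_at_minus1 \<mu> = (herglotz \<mu> (-1) - 1) / (herglotz \<mu> (-1) + 1)"
      unfolding psi_at_minus1_def psi_theta_def
      by (intro tendsto_Lim nontrivial_at_minus1 tendsto_intros lim nz)
    moreover have "norm (herglotz \<mu> (-1) - 1) = norm (herglotz \<mu> (-1) + 1)"
      using re by (simp add: cmod_def)
    ultimately show ?thesis using nz by (simp add: norm_divide)
  next
    case True
    let ?R = "\<lambda>z. \<Sum>w\<in>support \<mu> - {-1}. of_real (\<mu> w) * ((w + z) / (w - z))"
    have h: "herglotz \<mu> z = ?R z + (of_real (\<mu> (-1)) * (z - 1)) / (- 1 - z)" for z
      unfolding herglotz_support by (subst sum.remove[OF centered_finite[OF c] True]) simp
    have m: "\<mu> (-1) \<noteq> 0" using True by (simp add: support_def)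
    have "filterlim (\<lambda>z. - 1 - z) (at 0) ?F"
      unfolding filterlim_at by (auto intro!: tendsto_eq_intros simp: eventually_at_filter)
    then have "filterlim (\<lambda>z. (of_real (\<mu> (-1)) * (z - 1)) / (- 1 - z)) at_infinity ?F"
      using m by (intro filterlim_divide_at_infinity[where c = "of_real (\<mu> (-1)) * (-1 - 1)"])
        (auto intro!: tendsto_eq_intros)
    then have "filterlim (herglotz \<mu>) at_infinity ?F"
      unfolding h[abs_def] by (intro tendsto_add_filterlim_at_infinity[OF tend]) auto
    then have inv: "((\<lambda>z. inverse (herglotz \<mu> z)) \<longlongrightarrow> 0) ?F"
      and ev: "eventually (\<lambda>z. herglotz \<mu> z \<noteq> 0) ?F"
      by (auto simp: filterlim_at_infinity_imp_eventually_ne intro: filterlim_compose[OF tendsto_inverse_0])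
    \<comment> \<open>Dividing numerator and denominator of \<open>psi_theta \<mu>\<close> by
      \<open>herglotz \<mu>\<close> removes the pole.\<close>
    have "((\<lambda>z. (1 - inverse (herglotz \<mu> z)) / (1 + inverse (herglotz \<mu> z))) \<longlongrightarrow> (1 - 0) / (1 + 0)) ?F"
      by (intro tendsto_intros inv) auto
    then have "(psi_theta \<mu> \<longlongrightarrow> (1 - 0) / (1 + 0)) ?F"
    proof (rule Lim_transform_eventually)
      show "\<forall>\<^sub>F z in ?F. (1 - inverse (herglotz \<mu> z)) / (1 + inverse (herglotz \<mu> z)) = psi_theta \<mu> z"
        using ev
      proof eventually_elim
        case (elim z)
        then have "psi_theta \<mu> z = (herglotz \<mu> z * (1 - inverse (herglotz \<mu> z))) / (herglotz \<mu> z * (1 + inverse (herglotz \<mu> z)))"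
          by (simp add: psi_theta_def algebra_simps)
        then show ?case using elim by simp
      qed
    qed
    then have "psi_at_minus1 \<mu> = 1"
      unfolding psi_at_minus1_def by (intro tendsto_Lim nontrivial_at_minus1) simp
    then show ?thesis by simp
  qed
qed

text \<open>A unimodular constant times its conjugate is \<open>1\<close>, so the test conditions
  can be written with \<open>psi_theta\<close> itself.\<close>

lemma K_Psi_Psi_set_iff:
  "k \<in> K_Psi Psi_set \<longleftrightarrow> psd_kernel k \<and>
     (\<forall>\<mu>\<in>theta_hat. psd_kernel (\<lambda>x y. (1 - psi_theta \<mu> x * cnj (psi_theta \<mu> y)) * k x y))"
proof -
  have "cnj (psi_at_minus1 \<mu>) * psi_theta \<mu> x * cnj (cnj (psi_at_minus1 \<mu>) * psi_theta \<mu> y)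
     = psi_theta \<mu> x * cnj (psi_theta \<mu> y)" if "\<mu> \<in> theta_hat" for \<mu> x y
  proof -
    have "psi_at_minus1 \<mu> * cnj (psi_at_minus1 \<mu>) = 1"
      using norm_psi_at_minus1[OF that] by (simp add: complex_norm_square[symmetric])
    then show ?thesis by (simp add: mult_ac)
  qed
  note eq = this
  have Psi: "(\<forall>\<psi>\<in>Psi_set. P \<psi>) \<longleftrightarrow> (\<forall>\<mu>\<in>theta_hat. P (\<lambda>z. cnj (psi_at_minus1 \<mu>) * psi_theta \<mu> z))" for P
    unfolding Psi_set_def by blast
  show ?thesis
    unfolding K_Psi_def mem_Collect_eq Psi by (intro conj_cong refl ball_cong) (simp only: eq)
qed

text \<open>Adding an imaginary constant to \<open>h\<close> leaves this kernel unchanged, so it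
  suffices to recover \<open>h\<close> from its real part on the circle up to such a
  constant.\<close>

definition sum_kernel ::
    "(complex \<Rightarrow> complex) \<Rightarrow> (complex \<Rightarrow> complex \<Rightarrow> complex) \<Rightarrow> complex \<Rightarrow> complex \<Rightarrow> complex" where
  "sum_kernel h k x y = (h x + cnj (h y)) * k x y"

lemma psd_sum_kernel_theta_hat:
  assumes "k \<in> K_Psi Psi_set" "\<mu> \<in> theta_hat"
  shows "psd_kernel (sum_kernel (herglotz \<mu>) k)"
proof -
  \<comment> \<open>The division by \<open>sqrt 2\<close> absorbs the factor \<open>2\<close> of
    \<open>cayley_transform_kernel\<close>.\<close>
  let ?g = "\<lambda>x. (herglotz \<mu> x + 1) / of_real (sqrt 2)"
  let ?k = "\<lambda>x y. ?g x * cnj (?g y) * ((1 - psi_theta \<mu> x * cnj (psi_theta \<mu> y)) * k x y)"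
  have "psd_kernel ?k"
    by (rule psd_kernel_conjugate) (use assms in \<open>simp add: K_Psi_Psi_set_iff\<close>)
  then show ?thesis
  proof (rule psd_kernel_cong)
    fix u v :: complex assume uv: "u \<in> ball 0 1" "v \<in> ball 0 1"
    note nz = uv[THEN herglotz_plus_1_nonzero[OF theta_hat_centered(1)[OF assms(2)]]]
    have 2: "complex_of_real (sqrt 2) * of_real (sqrt 2) = 2"
      by (simp flip: of_real_mult)
    have "?k u v = (herglotz \<mu> u + 1) * cnj (herglotz \<mu> v + 1) *
        (1 - psi_theta \<mu> u * cnj (psi_theta \<mu> v)) / (of_real (sqrt 2) * of_real (sqrt 2)) * k u v"
      by (simp del: complex_cnj_add)
    also have "\<dots> = sum_kernel (herglotz \<mu>) k u v"
      unfolding 2 unfolding psi_theta_def cayley_transform_kernel[OF nz] sum_kernel_def by simp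
    finally show "sum_kernel (herglotz \<mu>) k u v = ?k u v" ..
  qed
qed

text \<open>A centred measure is a positive combination of elements of \<open>theta_hat\<close>: subtracting the
  largest admissible multiple of one whose atoms are atoms of the measure removes an atom.\<close>

lemma psd_sum_kernel_centered:
  assumes k: "k \<in> K_Psi Psi_set" and "centered m"
  shows "psd_kernel (sum_kernel (herglotz m) k)"
  using assms(2)
proof (induction "card (support m)" arbitrary: m rule: less_induct)
  case less
  note c = less.prems
  note fin = centered_finite[OF c]
  show ?case
  proof (cases "support m = {}")
    case True
    then have "sum_kernel (herglotz m) k = (\<lambda>x y. 0)"
      by (simp add: sum_kernel_def herglotz_support fun_eq_iff)
    then show ?thesis by (simp add: psd_kernel_0)
  next
    case False
    define s where "s = sum m (support m)"
    have mpos: "m w > 0" if "w \<in> support m" for w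
      using that centered_nonneg[OF c, of w] by (auto simp: support_def)
    have "s > 0" unfolding s_def using fin False mpos by (intro sum_pos) auto
    \<comment> \<open>Normalising by the total mass turns the vanishing first moment into a convex
      combination equal to \<open>0\<close>.\<close>
    have "0 \<in> convex hull (support m)"
    proof -
      have "(\<Sum>w\<in>support m. (m w / s) *\<^sub>R w) = (\<Sum>w\<in>support m. of_real (m w) * w) / of_real s"
        by (simp add: scaleR_conv_of_real sum_divide_distrib)
      then have "(\<Sum>w\<in>support m. (m w / s) *\<^sub>R w) = 0"
        using centered_mean[OF c] by simp
      moreover have "(\<Sum>w\<in>support m. m w / s) = 1"
        using \<open>s > 0\<close> by (simp add: s_def flip: sum_divide_distrib)
      moreover have "\<forall>w\<in>support m. 0 \<le> m w / s"
        using \<open>s > 0\<close> centered_nonneg[OF c] by simp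
      ultimately show ?thesis
        unfolding convex_hull_finite[OF fin] by (intro CollectI exI[of _ "\<lambda>w. m w / s"]) auto
    qed
    then obtain \<mu> where \<mu>: "\<mu> \<in> theta_hat" "support \<mu> \<subseteq> support m"
      using theta_hat_exists[of "support m"] c unfolding centered_def by blast
    note c\<mu> = theta_hat_centered[OF \<mu>(1)]
    note fin\<mu> = centered_finite[OF c\<mu>(1)]
    have \<mu>pos: "\<mu> w > 0" if "w \<in> support \<mu>" for w
      using that centered_nonneg[OF c\<mu>(1), of w] by (auto simp: support_def)
    have ne: "support \<mu> \<noteq> {}" using c\<mu>(2) by auto
    define t where "t = Min ((\<lambda>w. m w / \<mu> w) ` support \<mu>)"
    have tle: "t \<le> m w / \<mu> w" if "w \<in> support \<mu>" for w
      unfolding t_def using that fin\<mu> by simp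
    have "t \<in> (\<lambda>w. m w / \<mu> w) ` support \<mu>"
      unfolding t_def using fin\<mu> ne by (intro Min_in) auto
    then obtain w0 where w0: "w0 \<in> support \<mu>" "t = m w0 / \<mu> w0"
      by (elim imageE)
    have "t > 0" using w0 mpos \<mu>pos \<mu>(2) by auto
    define m' where "m' = (\<lambda>w. m w - t * \<mu> w)"
    have supp': "support m' \<subset> support m"
    proof -
      have "w0 \<in> support m" using w0 \<mu>(2) by auto
      moreover have "w0 \<notin> support m'" using w0 \<mu>pos[OF w0(1)] by (simp add: m'_def support_def)
      moreover have "support m' \<subseteq> support m"
        using \<mu>(2) by (auto simp: support_def m'_def)
      ultimately show ?thesis by blast
    qed
    have nn: "0 \<le> m' w" for w
    proof (cases "w \<in> support \<mu>")
      case True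
      then show ?thesis using tle[OF True] \<mu>pos[OF True] by (simp add: m'_def field_simps)
    next
      case False
      then show ?thesis using centered_nonneg[OF c] by (simp add: m'_def support_def)
    qed
    have lin: "(\<Sum>w\<in>support m'. of_real (m' w) * g w) = (\<Sum>w\<in>support m. of_real (m w) * g w)
        - of_real t * (\<Sum>w\<in>support \<mu>. of_real (\<mu> w) * g w)" for g :: "complex \<Rightarrow> complex"
      unfolding sum_support_superset[OF fin \<mu>(2)] sum_support_superset[OF fin psubset_imp_subset[OF supp']]
      by (simp add: m'_def algebra_simps sum_subtractf sum_distrib_left)
    have c': "centered m'"
      unfolding centered_def lin[of "\<lambda>w. w"] centered_mean[OF c] centered_mean[OF c\<mu>(1)]
      using nn supp' c finite_subset[OF _ fin] unfolding centered_def by auto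
    have "psd_kernel (\<lambda>x y. sum_kernel (herglotz m') k x y + of_real t * sum_kernel (herglotz \<mu>) k x y)"
      using less.hyps[OF psubset_card_mono[OF fin supp'] c'] psd_sum_kernel_theta_hat[OF k \<mu>(1)] \<open>t > 0\<close>
      by (intro psd_kernel_add psd_kernel_scale) auto
    moreover have "herglotz m' z = herglotz m z - of_real t * herglotz \<mu> z" for z
      unfolding herglotz_support by (rule lin)
    then have "sum_kernel (herglotz m) k x y =
        sum_kernel (herglotz m') k x y + of_real t * sum_kernel (herglotz \<mu>) k x y" for x y
      by (simp add: sum_kernel_def) (simp add: algebra_simps)
    ultimately show ?thesis
      by (elim psd_kernel_cong)
  qed
qed

subsection \<open>Discretised Herglotz representation\<close>

text \<open>Multiplication by a primitive root \<open>\<omega>\<close> permutes the roots of unity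
  and multiplies the sum by \<open>\<omega> ^ d\<close>, which differs from \<open>1\<close> unless
  \<open>N\<close> divides \<open>d\<close>; the sum then vanishes.\<close>

lemma sum_root_unity_powers:
  assumes "0 < N"
  shows "(\<Sum>w | w ^ N = 1. w ^ d) = (if N dvd d then of_nat N else (0 :: complex))"
proof (cases "N dvd d")
  case True
  then obtain e where "d = N * e" by blast
  then have "(\<Sum>w :: complex | w ^ N = 1. w ^ d) = (\<Sum>w :: complex | w ^ N = 1. 1)"
    by (intro sum.cong) (auto simp: power_mult)
  then show ?thesis using True assms by (simp add: card_roots_unity_eq)
next
  case False
  define \<omega> where "\<omega> = exp (2 * of_real pi * \<i> * of_nat 1 / of_nat N)"
  have \<omega>: "\<omega> ^ N = 1" unfolding \<omega>_def using assms by (intro complex_root_unity) auto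
  have "\<omega> ^ d = exp (2 * of_real pi * \<i> * of_nat d / of_nat N)"
    unfolding \<omega>_def by (simp add: exp_of_nat_mult[symmetric] mult_ac)
  then have "\<omega> ^ d \<noteq> 1"
    using complex_root_unity_eq_1[of N d] assms False by simp
  have nz: "\<omega> \<noteq> 0" by (simp add: \<omega>_def)
  have "bij_betw (\<lambda>w. \<omega> * w) {w. w ^ N = 1} {w. w ^ N = 1}"
    by (rule bij_betw_byWitness[where f' = "\<lambda>w. w / \<omega>"])
       (use \<omega> nz in \<open>auto simp: power_mult_distrib power_divide\<close>)
  then have "(\<Sum>w | w ^ N = 1. w ^ d) = (\<Sum>w | w ^ N = 1. (\<omega> * w) ^ d)"
    by (rule sum.reindex_bij_betw[symmetric])
  also have "\<dots> = \<omega> ^ d * (\<Sum>w | w ^ N = 1. w ^ d)"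
    by (simp add: power_mult_distrib sum_distrib_left)
  finally have "(1 - \<omega> ^ d) * (\<Sum>w | w ^ N = 1. w ^ d) = 0" by (simp add: algebra_simps)
  then show ?thesis using \<open>\<omega> ^ d \<noteq> 1\<close> False by simp
qed

lemma norm_root_unity: "w ^ N = (1 :: complex) \<Longrightarrow> 0 < N \<Longrightarrow> norm w = 1"
  by (metis norm_one norm_power power_eq_1_iff norm_ge_zero less_irrefl)

text \<open>On roots of unity conjugation becomes a nonnegative power, so real parts of polynomials
  become polynomials and orthogonality applies to them.\<close>

lemma cnj_root_unity_power:
  fixes w :: complex
  assumes "w ^ N = 1" "0 < N" "n \<le> N"
  shows "cnj w ^ n = w ^ (N - n)"
proof -
  have 1: "cnj w * w = 1"
    using norm_root_unity[OF assms(1,2)] by (simp add: mult.commute complex_norm_square[symmetric])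
  have "cnj w ^ n * (w ^ n * w ^ (N - n)) = w ^ (N - n)"
    using 1 by (simp flip: mult.assoc power_mult_distrib)
  then show ?thesis using assms by (simp flip: power_add)
qed

lemma power_neq_1_ball:
  fixes z :: complex
  assumes "norm z < 1" "0 < N"
  shows "z ^ N \<noteq> 1"
  using norm_root_unity[of z N] assms by auto

text \<open>A discrete Cauchy integral formula for \<open>z ^ n\<close>. On the roots,
  \<open>w / (w - z)\<close> is a geometric series in \<open>z * cnj w\<close> whose powers of
  \<open>cnj w\<close> repeat with period \<open>N\<close>; collecting the repetitions gives the
  factor \<open>1 / (1 - z ^ N)\<close>, and orthogonality selects the term
  \<open>m = n\<close>.\<close>

lemma sum_root_unity_cauchy:
  fixes z :: complex
  assumes "norm z < 1" "n < N"
  shows "(\<Sum>w | w ^ N = 1. w ^ n * (w / (w - z))) = of_nat N * z ^ n / (1 - z ^ N)"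
proof -
  have N: "0 < N" using assms by simp
  note nz = power_neq_1_ball[OF assms(1) N]
  have "w ^ n * (w / (w - z)) = (\<Sum>m<N. z ^ m * w ^ (n + (N - m))) / (1 - z ^ N)" if w: "w ^ N = 1" for w
  proof -
    have 1: "cnj w * w = 1"
      using norm_root_unity[OF w N] by (simp add: mult.commute complex_norm_square[symmetric])
    have "w \<noteq> z" using norm_root_unity[OF w N] assms(1) by auto
    have "(w - z) * (\<Sum>m<N. (z * cnj w) ^ m) = w * ((1 - z * cnj w) * (\<Sum>m<N. (z * cnj w) ^ m))"
      using 1 by (simp add: algebra_simps)
    also have "(1 - z * cnj w) * (\<Sum>m<N. (z * cnj w) ^ m) = 1 - z ^ N"
      unfolding one_diff_power_eq[symmetric] by (simp add: power_mult_distrib w flip: complex_cnj_power)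
    finally have "w / (w - z) = (\<Sum>m<N. (z * cnj w) ^ m) / (1 - z ^ N)"
      using nz \<open>w \<noteq> z\<close> by (simp add: field_simps)
    also have "(\<Sum>m<N. (z * cnj w) ^ m) = (\<Sum>m<N. z ^ m * w ^ (N - m))"
      by (intro sum.cong) (auto simp: power_mult_distrib cnj_root_unity_power[OF w N])
    finally have e: "w / (w - z) = (\<Sum>m<N. z ^ m * w ^ (N - m)) / (1 - z ^ N)" .
    show ?thesis
      unfolding e by (simp only: sum_distrib_left times_divide_eq_right power_add mult_ac)
  qed
  then have "(\<Sum>w | w ^ N = 1. w ^ n * (w / (w - z)))
      = (\<Sum>w | w ^ N = 1. \<Sum>m<N. z ^ m * w ^ (n + (N - m))) / (1 - z ^ N)"
    by (simp add: sum_divide_distrib)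
  also have "(\<Sum>w | w ^ N = 1. \<Sum>m<N. z ^ m * w ^ (n + (N - m)))
      = (\<Sum>m<N. z ^ m * (\<Sum>w | w ^ N = 1. w ^ (n + (N - m))))"
    by (subst sum.swap) (simp add: sum_distrib_left)
  also have "\<dots> = (\<Sum>m<N. if m = n then of_nat N * z ^ n else 0)"
  proof (rule sum.cong[OF refl])
    fix m assume m: "m \<in> {..<N}"
    have "N dvd n + (N - m) \<longleftrightarrow> m = n"
    proof
      assume "N dvd n + (N - m)"
      then obtain e where e: "n + (N - m) = N * e" by blast
      \<comment> \<open>The exponent lies strictly between \<open>0\<close> and
        \<open>2 * N\<close>, so \<open>N\<close> is the only multiple it can be.\<close>
      have "0 < n + (N - m)" "n + (N - m) < N * 2" using m assms(2) by auto
      then have "0 < N * e" "N * e < N * 2" unfolding e .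
      then have "e = 1" by auto
      then show "m = n" using e m by auto
    qed (use m in auto)
    then show "z ^ m * (\<Sum>w | w ^ N = 1. w ^ (n + (N - m))) = (if m = n then of_nat N * z ^ n else 0)"
      unfolding sum_root_unity_powers[OF N] by simp
  qed
  also have "\<dots> = of_nat N * z ^ n" using assms by (simp add: sum.delta)
  finally show ?thesis .
qed

text \<open>The \<open>N\<close>-point quadrature rule for normalised arc length on the
  circle.\<close>

definition root_average :: "nat \<Rightarrow> (complex \<Rightarrow> complex) \<Rightarrow> complex" where
  "root_average N g = (\<Sum>w | w ^ N = 1. g w) / of_nat N"

lemma root_average_power:
  "0 < N \<Longrightarrow> root_average N (\<lambda>w. w ^ d) = (if N dvd d then 1 else 0)"
  by (simp add: root_average_def sum_root_unity_powers)

lemma root_average_cauchy: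
  "norm z < 1 \<Longrightarrow> n < N \<Longrightarrow> root_average N (\<lambda>w. w ^ n * (w / (w - z))) = z ^ n / (1 - z ^ N)"
  by (subst root_average_def, subst sum_root_unity_cauchy) auto

lemma root_average_add: "root_average N (\<lambda>w. g w + g' w) = root_average N g + root_average N g'"
  by (simp add: root_average_def sum.distrib add_divide_distrib)

lemma root_average_diff: "root_average N (\<lambda>w. g w - g' w) = root_average N g - root_average N g'"
  by (simp add: root_average_def sum_subtractf diff_divide_distrib)

lemma root_average_mult: "root_average N (\<lambda>w. a * g w) = a * root_average N g"
  by (simp add: root_average_def sum_distrib_left)

lemma root_average_sum: "root_average N (\<lambda>w. \<Sum>n\<in>A. g n w) = (\<Sum>n\<in>A. root_average N (g n))"
  by (induction A rule: infinite_finite_induct) (simp_all add: root_average_add, simp_all add: root_average_def)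

lemma root_average_cong:
  "(\<And>w. w ^ N = 1 \<Longrightarrow> g w = g' w) \<Longrightarrow> root_average N g = root_average N g'"
  by (simp add: root_average_def)

lemma Re_root_unity_monomial:
  fixes w b :: complex
  assumes "w ^ N = 1" "0 < N" "n \<le> N"
  shows "of_real (Re (b * w ^ n)) = b / 2 * w ^ n + cnj b / 2 * w ^ (N - n)"
  using complex_add_cnj[of "b * w ^ n"] cnj_root_unity_power[OF assms] by (simp add: field_simps)

text \<open>The real part of \<open>b * w ^ n\<close> has frequencies \<open>n\<close> and
  \<open>-n\<close>, which the factor \<open>w\<close> shifts to \<open>n + 1\<close> and
  \<open>1 - n\<close>. Frequency \<open>0\<close> arises only for \<open>n = 1\<close>, which is
  how the derivative at \<open>0\<close> governs the barycentre; \<open>n + 1 < N\<close> excludes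
  aliasing.\<close>

lemma root_average_Re_monomial_mean:
  assumes "n \<noteq> 1" "n + 1 < N"
  shows "root_average N (\<lambda>w. of_real (Re (b * w ^ n)) * w) = 0"
proof -
  have "root_average N (\<lambda>w. of_real (Re (b * w ^ n)) * w) =
     root_average N (\<lambda>w. b / 2 * w ^ (n + 1) + cnj b / 2 * w ^ (N - n + 1))"
    using assms by (intro root_average_cong) (subst Re_root_unity_monomial, auto simp: algebra_simps)
  also have "\<dots> = b / 2 * root_average N (\<lambda>w. w ^ (n + 1)) + cnj b / 2 * root_average N (\<lambda>w. w ^ (N - n + 1))"
    by (simp only: root_average_add root_average_mult)
  also have "\<dots> = 0"
  proof -
    have 1: "\<not> N dvd n + 1" using assms by (auto dest: dvd_imp_le)
    \<comment> \<open>For \<open>n \<ge> 2\<close> the exponent lies strictly between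
      \<open>0\<close> and \<open>N\<close>; for \<open>n = 0\<close> it is \<open>N + 1\<close> and
      a separate argument is made.\<close>
    have 2: "\<not> N dvd N - n + 1"
    proof (cases "n = 0")
      case True
      have "\<not> N dvd 1" using assms by auto
      then show ?thesis using True by (simp only: diff_zero dvd_add_triv_left_iff) simp
    qed (use assms in \<open>auto dest: dvd_imp_le\<close>)
    have N: "0 < N" using assms by simp
    show ?thesis unfolding root_average_power[OF N] using 1 2 by simp
  qed
  finally show ?thesis .
qed

text \<open>The identity \<open>(w + z) / (w - z) = 2 * (w / (w - z)) - 1\<close> reduces this to
  the discrete Cauchy formula at the exponents \<open>n\<close> and \<open>N - n\<close>. The case
  \<open>n = 0\<close> stands apart because \<open>N - n\<close> is then not below
  \<open>N\<close>.\<close>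

lemma root_average_Re_monomial_herglotz:
  assumes "norm z < 1" "n < N"
  shows "root_average N (\<lambda>w. of_real (Re (b * w ^ n)) * ((w + z) / (w - z))) =
    (if n = 0 then of_real (Re b) * (2 / (1 - z ^ N) - 1)
     else (b * z ^ n + cnj b * z ^ (N - n)) / (1 - z ^ N))"
proof -
  have N: "0 < N" using assms by simp
  have r: "(w + z) / (w - z) = 2 * (w / (w - z)) - 1" if "w ^ N = 1" for w
  proof -
    have "w \<noteq> z" using norm_root_unity[OF that N] assms(1) by auto
    then show ?thesis by (simp add: field_simps)
  qed
  show ?thesis
  proof (cases "n = 0")
    case True
    have "root_average N (\<lambda>w. of_real (Re (b * w ^ n)) * ((w + z) / (w - z))) =
      root_average N (\<lambda>w. of_real (Re b) * (2 * (w ^ 0 * (w / (w - z))) - w ^ 0))"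
      by (intro root_average_cong) (simp add: r True)
    also have "\<dots> = of_real (Re b) * (2 / (1 - z ^ N) - 1)"
      unfolding root_average_mult root_average_diff root_average_cauchy[OF assms(1) N] root_average_power[OF N]
      by simp
    finally show ?thesis using True by simp
  next
    case False
    have alg: "(b / 2 * A + cnj b / 2 * B) * (2 * W - 1) =
        b * (A * W) + cnj b * (B * W) - (b / 2 * A + cnj b / 2 * B)" for A B W
      by (simp add: field_simps)
    have "root_average N (\<lambda>w. of_real (Re (b * w ^ n)) * ((w + z) / (w - z))) =
      root_average N (\<lambda>w. b * (w ^ n * (w / (w - z))) + cnj b * (w ^ (N - n) * (w / (w - z)))
         - (b / 2 * w ^ n + cnj b / 2 * w ^ (N - n)))"
      using assms N
      by (intro root_average_cong, subst Re_root_unity_monomial) (auto simp only: r alg)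
    also have "\<dots> = b * (z ^ n / (1 - z ^ N)) + cnj b * (z ^ (N - n) / (1 - z ^ N))"
    proof -
      have n: "0 < n" "N - n < N" using assms False by auto
      show ?thesis
        unfolding root_average_mult root_average_diff root_average_add root_average_power[OF N]
          root_average_cauchy[OF assms] root_average_cauchy[OF assms(1) n(2)]
        using assms n by (simp add: nat_dvd_not_less)
    qed
    finally show ?thesis using False by (simp add: add_divide_distrib)
  qed
qed

text \<open>The aliasing terms carry powers of \<open>z\<close> that grow with \<open>N\<close>. For
  \<open>n = 0\<close> the sampled function is the constant \<open>Re b\<close>, so the imaginary
  part of \<open>b\<close> is lost.\<close>

lemma root_average_Re_monomial_limit:
  assumes "norm z < 1"
  shows "(\<lambda>N. root_average (N + M + 2) (\<lambda>w. of_real (Re (b * w ^ n)) * ((w + z) / (w - z))))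
    \<longlonglongrightarrow> b * z ^ n - (if n = 0 then \<i> * of_real (Im b) else 0)"
proof -
  have pow: "(\<lambda>N. z ^ N) \<longlonglongrightarrow> 0" using assms by (rule LIMSEQ_power_zero)
  have powM: "(\<lambda>N. z ^ (N + M + 2)) \<longlonglongrightarrow> 0"
    using LIMSEQ_ignore_initial_segment[OF pow, of "M + 2"] by (simp add: add.assoc)
  have powMn: "(\<lambda>N. z ^ (N + M + 2 - n)) \<longlonglongrightarrow> 0"
  proof (rule LIMSEQ_offset[where k = n])
    show "(\<lambda>N. z ^ (N + n + M + 2 - n)) \<longlonglongrightarrow> 0"
      using powM by simp
  qed
  show ?thesis
  proof (cases "n = 0")
    case True
    have "(\<lambda>N. complex_of_real (Re b) * (2 / (1 - z ^ (N + M + 2)) - 1)) \<longlonglongrightarrow> of_real (Re b) * (2 / (1 - 0) - 1)"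
      by (intro tendsto_intros powM) auto
    moreover have "b - \<i> * of_real (Im b) = of_real (Re b)" by (simp add: complex_eq_iff)
    ultimately show ?thesis
      using True assms by (simp add: root_average_Re_monomial_herglotz[where n = 0, simplified])
  next
    case False
    have lim: "(\<lambda>N. (b * z ^ n + cnj b * z ^ (N + M + 2 - n)) / (1 - z ^ (N + M + 2)))
       \<longlonglongrightarrow> (b * z ^ n + cnj b * 0) / (1 - 0)"
      by (intro tendsto_intros powM powMn) auto
    have "(\<lambda>N. root_average (N + M + 2) (\<lambda>w. of_real (Re (b * w ^ n)) * ((w + z) / (w - z))))
       \<longlonglongrightarrow> (b * z ^ n + cnj b * 0) / (1 - 0)"
    proof (rule Lim_transform_eventually[OF lim])
      show "\<forall>\<^sub>F N in sequentially. (b * z ^ n + cnj b * z ^ (N + M + 2 - n)) / (1 - z ^ (N + M + 2)) =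
        root_average (N + M + 2) (\<lambda>w. of_real (Re (b * w ^ n)) * ((w + z) / (w - z)))"
        using eventually_ge_at_top[of n]
        by eventually_elim (subst root_average_Re_monomial_herglotz, use assms False in auto)
    qed
    then show ?thesis using False by simp
  qed
qed

section \<open>Positivity for functions with nonnegative real part, and for contractive
  functions\<close>

lemma psd_sum_kernel_polynomial:
  assumes k: "k \<in> K_Psi Psi_set" and b1: "b 1 = 0"
    and q: "\<And>w. norm w = 1 \<Longrightarrow> 0 \<le> Re (\<Sum>n\<le>M. b n * w ^ n)"
  shows "psd_kernel (sum_kernel (\<lambda>z. \<Sum>n\<le>M. b n * z ^ n) k)"
proof -
  let ?q = "\<lambda>z. \<Sum>n\<le>M. b n * z ^ n"
  \<comment> \<open>The order \<open>N + M + 2\<close> exceeds \<open>n + 1\<close> for every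
    \<open>n \<le> M\<close>, so each of these measures is centred exactly.\<close>
  define m where "m = (\<lambda>N w. if w ^ (N + M + 2) = 1 then Re (?q w) / real (N + M + 2) else 0)"
  have avg: "(\<Sum>w\<in>support (m N). of_real (m N w) * g w)
      = (\<Sum>n\<le>M. root_average (N + M + 2) (\<lambda>w. of_real (Re (b n * w ^ n)) * g w))" for N g
  proof -
    let ?R = "{w :: complex. w ^ (N + M + 2) = 1}"
    have fin: "finite ?R" by (intro finite_roots_unity) simp
    have "support (m N) \<subseteq> ?R" by (auto simp: support_def m_def)
    then have "(\<Sum>w\<in>support (m N). of_real (m N w) * g w) = (\<Sum>w\<in>?R. of_real (m N w) * g w)"
      by (rule sum_support_superset[OF fin])
    also have "\<dots> = root_average (N + M + 2) (\<lambda>w. of_real (Re (?q w)) * g w)"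
      unfolding root_average_def sum_divide_distrib by (intro sum.cong) (auto simp: m_def)
    also have "\<dots> = (\<Sum>n\<le>M. root_average (N + M + 2) (\<lambda>w. of_real (Re (b n * w ^ n)) * g w))"
      by (simp only: Re_sum of_real_sum sum_distrib_right root_average_sum)
    finally show ?thesis .
  qed
  have c: "centered (m N)" for N
  proof -
    have sub: "support (m N) \<subseteq> {w. w ^ (N + M + 2) = 1}" by (auto simp: support_def m_def)
    have nr: "norm w = 1" if "w ^ (N + M + 2) = 1" for w :: complex
      using norm_root_unity[OF that] by simp
    have "(\<Sum>w\<in>support (m N). of_real (m N w) * w) = 0"
      unfolding avg[of N "\<lambda>w. w"]
    proof (intro sum.neutral ballI)
      fix n assume "n \<in> {..M}"
      show "root_average (N + M + 2) (\<lambda>w. of_real (Re (b n * w ^ n)) * w) = 0"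
      proof (cases "n = 1")
        case True
        show ?thesis unfolding True b1 by (simp add: root_average_def)
      next
        case False
        then show ?thesis
          using \<open>n \<in> {..M}\<close> by (intro root_average_Re_monomial_mean) auto
      qed
    qed
    moreover have "finite (support (m N))"
      using sub by (rule finite_subset) (intro finite_roots_unity, simp)
    moreover have "support (m N) \<subseteq> sphere 0 1" using sub nr by auto
    moreover have "0 \<le> m N w" for w
      unfolding m_def using q[OF nr] by (simp del: Re_sum)
    ultimately show ?thesis unfolding centered_def by blast
  qed
  have lim: "(\<lambda>N. herglotz (m N) z) \<longlonglongrightarrow> ?q z - \<i> * of_real (Im (b 0))" if "z \<in> ball 0 1" for z
  proof -
    have "(\<lambda>N. \<Sum>n\<le>M. root_average (N + M + 2) (\<lambda>w. of_real (Re (b n * w ^ n)) * ((w + z) / (w - z))))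
       \<longlonglongrightarrow> (\<Sum>n\<le>M. b n * z ^ n - (if n = 0 then \<i> * of_real (Im (b n)) else 0))"
      using that by (intro tendsto_sum root_average_Re_monomial_limit) auto
    then show ?thesis
      unfolding herglotz_support avg by (simp add: sum_subtractf)
  qed
  show ?thesis
  proof (rule psd_kernel_limit)
    show "psd_kernel (sum_kernel (herglotz (m N)) k)" for N
      by (rule psd_sum_kernel_centered[OF k c])
    fix u v :: complex assume uv: "u \<in> ball 0 1" "v \<in> ball 0 1"
    have "(\<lambda>N. sum_kernel (herglotz (m N)) k u v) \<longlonglongrightarrow>
       (?q u - \<i> * of_real (Im (b 0)) + cnj (?q v - \<i> * of_real (Im (b 0)))) * k u v"
      unfolding sum_kernel_def by (intro tendsto_intros lim uv)
    \<comment> \<open>The imaginary constant lost in the limit cancels against its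
      conjugate.\<close>
    then show "(\<lambda>N. sum_kernel (herglotz (m N)) k u v) \<longlonglongrightarrow> sum_kernel ?q k u v"
      by (simp add: sum_kernel_def)
  qed
qed

text \<open>Dilation by \<open>r < 1\<close> makes the Taylor series absolutely convergent on the
  closed disc. A partial sum may have slightly negative real part on the circle; raising its
  constant term by the tail \<open>\<epsilon> M\<close> repairs this and leaves the coefficient of
  \<open>z\<close> at zero.\<close>

lemma psd_sum_kernel_holomorphic:
  assumes k: "k \<in> K_Psi Psi_set" and h: "h holomorphic_on ball 0 1" "deriv h 0 = 0"
    and re: "\<And>z. z \<in> ball 0 1 \<Longrightarrow> 0 \<le> Re (h z)"
  shows "psd_kernel (sum_kernel h k)"
proof -
  define a where "a = (\<lambda>n. (deriv ^^ n) h 0 / fact n)"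
  have a: "(\<lambda>n. a n * z ^ n) sums h z" if "z \<in> ball 0 1" for z
    using holomorphic_power_series[OF h(1) that] by (simp add: a_def)
  have dil: "psd_kernel (sum_kernel (\<lambda>z. h (of_real r * z)) k)" if r: "0 < r" "r < 1" for r
  proof -
    define b where "b = (\<lambda>n. a n * of_real r ^ n)"
    have in_ball: "of_real r * z \<in> ball 0 1" if "norm z \<le> 1" for z :: complex
    proof -
      have "norm (of_real r * z) = r * norm z" using r by (simp add: norm_mult)
      also have "\<dots> \<le> r * 1" using r that by (intro mult_left_mono) auto
      finally show ?thesis using r by simp
    qed
    have bs: "(\<lambda>n. b n * z ^ n) sums h (of_real r * z)" if "norm z \<le> 1" for z
      using a[OF in_ball[OF that]] by (simp add: b_def power_mult_distrib mult_ac)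
    \<comment> \<open>Convergence at \<open>(1 + r) / 2\<close>, between \<open>r\<close> and
      \<open>1\<close>, gives absolute convergence at \<open>r\<close>.\<close>
    have "summable (\<lambda>n. norm (a n * of_real r ^ n))"
    proof (rule powser_insidea)
      show "summable (\<lambda>n. a n * of_real ((1 + r) / 2) ^ n)"
        using r by (intro sums_summable[OF a]) (simp del: of_real_divide of_real_add)
      show "norm (complex_of_real r) < norm (complex_of_real ((1 + r) / 2))"
        using r by (simp only: norm_of_real) simp
    qed
    then have sb: "summable (\<lambda>n. norm (b n))" by (simp add: b_def)
    define \<epsilon> where "\<epsilon> = (\<lambda>M. \<Sum>n. norm (b (n + Suc M)))"
    have eps: "\<epsilon> \<longlonglongrightarrow> 0"
      unfolding \<epsilon>_def using suminf_exist_split2[OF sb] by (rule LIMSEQ_Suc)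
    define q where "q = (\<lambda>M z. \<Sum>n\<le>M. (b n + (if n = 0 then of_real (\<epsilon> M) else 0)) * z ^ n)"
    have q_eq: "q M z = (\<Sum>n\<le>M. b n * z ^ n) + of_real (\<epsilon> M)" for M z
    proof -
      have "q M z = (\<Sum>n\<le>M. b n * z ^ n) + (\<Sum>n\<le>M. if n = 0 then of_real (\<epsilon> M) else 0)"
        unfolding q_def sum.distrib[symmetric] by (intro sum.cong) (auto simp: algebra_simps)
      then show ?thesis by simp
    qed
    have "psd_kernel (sum_kernel (q M) k)" for M
      unfolding q_def
    proof (rule psd_sum_kernel_polynomial[OF k])
      show "b 1 + (if 1 = (0::nat) then of_real (\<epsilon> M) else 0) = 0"
        using h(2) by (simp add: b_def a_def)
      fix w :: complex assume w: "norm w = 1"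
      have sbw: "summable (\<lambda>n. norm (b n * w ^ n))" using sb w by (simp add: norm_mult norm_power)
      have "h (of_real r * w) = (\<Sum>n. b (n + Suc M) * w ^ (n + Suc M)) + (\<Sum>n\<le>M. b n * w ^ n)"
        using suminf_split_initial_segment[OF sums_summable[OF bs], of w "Suc M"] sums_unique[OF bs, of w] w
        by (simp add: lessThan_Suc_atMost)
      moreover have "norm (\<Sum>n. b (n + Suc M) * w ^ (n + Suc M)) \<le> \<epsilon> M"
      proof -
        have "summable (\<lambda>n. norm (b (n + Suc M) * w ^ (n + Suc M)))"
          using sbw by (rule summable_ignore_initial_segment)
        from summable_norm[OF this] show ?thesis
          using w by (simp add: \<epsilon>_def norm_mult norm_power)
      qed
      moreover have "0 \<le> Re (h (of_real r * w))" using re[OF in_ball] w by simp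
      ultimately have "0 \<le> Re (q M w)"
        unfolding q_eq using complex_Re_le_cmod[of "\<Sum>n. b (n + Suc M) * w ^ (n + Suc M)"] by simp
      then show "0 \<le> Re (\<Sum>n\<le>M. (b n + (if n = 0 then of_real (\<epsilon> M) else 0)) * w ^ n)"
        by (simp only: q_def)
    qed
    then show ?thesis
    proof (rule psd_kernel_limit)
      have lim: "(\<lambda>M. q M z) \<longlonglongrightarrow> h (of_real r * z)" if "z \<in> ball 0 1" for z
      proof -
        have "(\<lambda>M. \<Sum>n\<le>M. b n * z ^ n) \<longlonglongrightarrow> h (of_real r * z)"
          using bs[of z] that unfolding sums_def_le by simp
        then have "(\<lambda>M. (\<Sum>n\<le>M. b n * z ^ n) + of_real (\<epsilon> M)) \<longlonglongrightarrow> h (of_real r * z) + of_real 0"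
          by (intro tendsto_intros eps)
        then show ?thesis unfolding q_eq by simp
      qed
      fix u v :: complex assume uv: "u \<in> ball 0 1" "v \<in> ball 0 1"
      show "(\<lambda>M. sum_kernel (q M) k u v) \<longlonglongrightarrow> sum_kernel (\<lambda>z. h (of_real r * z)) k u v"
        unfolding sum_kernel_def by (intro tendsto_intros lim uv)
    qed
  qed
  \<comment> \<open>The shift by \<open>2\<close> makes \<open>r 0\<close> positive.\<close>
  define r where "r = (\<lambda>n. 1 - 1 / real (n + 2))"
  have r: "0 < r n" "r n < 1" for n by (simp_all add: r_def)
  have rlim: "r \<longlonglongrightarrow> 1"
    unfolding r_def
    using tendsto_diff[OF tendsto_const LIMSEQ_ignore_initial_segment[OF lim_1_over_n[where 'a = real], of 2], of 1]
    by simp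
  show ?thesis
  proof (rule psd_kernel_limit)
    show "psd_kernel (sum_kernel (\<lambda>z. h (of_real (r n) * z)) k)" for n
      by (rule dil[OF r])
    have lim: "(\<lambda>n. h (of_real (r n) * z)) \<longlonglongrightarrow> h z" if "z \<in> ball 0 1" for z
    proof -
      have "isCont h z"
        using holomorphic_on_imp_continuous_on[OF h(1)] that
        by (simp add: continuous_on_eq_continuous_at)
      moreover have "(\<lambda>n. of_real (r n) * z) \<longlonglongrightarrow> z"
        using rlim by (auto intro!: tendsto_eq_intros)
      ultimately show ?thesis by (rule isCont_tendsto_compose)
    qed
    fix u v :: complex assume uv: "u \<in> ball 0 1" "v \<in> ball 0 1"
    show "(\<lambda>n. sum_kernel (\<lambda>z. h (of_real (r n) * z)) k u v) \<longlonglongrightarrow> sum_kernel h k u v"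
      unfolding sum_kernel_def by (intro tendsto_intros lim uv)
  qed
qed

text \<open>For \<open>s < 1\<close> the function \<open>s * f\<close> never takes the value
  \<open>1\<close>, so its Cayley transform \<open>(1 + s * f) / (1 - s * f)\<close> is holomorphic
  even if \<open>f\<close> is a unimodular constant. Its derivative at \<open>0\<close> vanishes
  with that of \<open>f\<close>, and its real part is nonnegative.\<close>

lemma Hinf_K_ball_PsiI:
  assumes f: "f holomorphic_on ball 0 1" "deriv f 0 = 0"
    and le: "\<And>z. z \<in> ball 0 1 \<Longrightarrow> norm (f z) \<le> 1"
  shows "f \<in> Hinf_K_ball Psi_set"
  unfolding Hinf_K_ball_def
proof (intro CollectI ballI)
  fix k assume k: "k \<in> K_Psi Psi_set"
  have scaled: "psd_kernel (\<lambda>x y. (1 - (of_real s * f x) * cnj (of_real s * f y)) * k x y)"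
    if s: "0 < s" "s < 1" for s
  proof -
    let ?f = "\<lambda>z. of_real s * f z"
    let ?h = "\<lambda>z. (1 + ?f z) / (1 - ?f z)"
    have lt: "norm (?f z) < 1" if "z \<in> ball 0 1" for z
    proof -
      have "norm (?f z) = s * norm (f z)" using s by (simp add: norm_mult)
      also have "\<dots> \<le> s * 1" using s le[OF that] by (intro mult_left_mono) auto
      finally show ?thesis using s by simp
    qed
    have nz: "1 - ?f z \<noteq> 0" if "z \<in> ball 0 1" for z
      using lt[OF that] by auto
    have id: "?h x + cnj (?h y) = 2 * (1 - ?f x * cnj (?f y)) / ((1 - ?f x) * cnj (1 - ?f y))"
      if "x \<in> ball 0 1" "y \<in> ball 0 1" for x y
    proof -
      have "1 - ?f x \<noteq> 0" "1 - cnj (?f y) \<noteq> 0"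
        using nz[OF that(1)] nz[OF that(2)] by (auto simp flip: complex_cnj_mult)
      then show ?thesis
        by (simp add: add_frac_eq) (simp add: algebra_simps)
    qed
    have "psd_kernel (sum_kernel ?h k)"
    proof (rule psd_sum_kernel_holomorphic[OF k])
      show "?h holomorphic_on ball 0 1"
        using nz by (intro holomorphic_intros f) auto
      have "(f has_field_derivative 0) (at 0)"
        using holomorphic_derivI[OF f(1), of 0] f(2) by simp
      then have "(?h has_field_derivative 0) (at 0)"
        using nz[of 0] by (auto intro!: derivative_eq_intros)
      then show "deriv ?h 0 = 0" by (rule DERIV_imp_deriv)
      fix z :: complex assume z: "z \<in> ball 0 1"
      have "complex_of_real (2 * Re (?h z)) = ?h z + cnj (?h z)"
        by (simp only: complex_add_cnj)
      also have "\<dots> = of_real (2 * (1 - (norm (?f z))\<^sup>2) / (norm (1 - ?f z))\<^sup>2)"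
        unfolding id[OF z z] complex_norm_square[symmetric] by simp
      finally have "2 * Re (?h z) = 2 * (1 - (norm (?f z))\<^sup>2) / (norm (1 - ?f z))\<^sup>2"
        by (simp only: of_real_eq_iff)
      moreover have "(norm (?f z))\<^sup>2 \<le> 1"
        using lt[OF z] by (simp add: power_le_one del: norm_mult)
      ultimately show "0 \<le> Re (?h z)"
        by (smt (verit) divide_nonneg_nonneg zero_le_power2)
    qed
    \<comment> \<open>Conjugation clears the denominators of the Cayley transform, and
      \<open>1 / 2\<close> cancels its factor \<open>2\<close>.\<close>
    then have "psd_kernel (\<lambda>x y. of_real (1 / 2) * ((1 - ?f x) * cnj (1 - ?f y) * sum_kernel ?h k x y))"
      by (intro psd_kernel_scale psd_kernel_conjugate) auto
    then show ?thesis
    proof (rule psd_kernel_cong)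
      fix u v :: complex assume uv: "u \<in> ball 0 1" "v \<in> ball 0 1"
      have "cnj (1 - ?f v) \<noteq> 0" using nz[OF uv(2)] by (simp del: complex_cnj_diff)
      then show "(1 - ?f u * cnj (?f v)) * k u v =
          of_real (1 / 2) * ((1 - ?f u) * cnj (1 - ?f v) * sum_kernel ?h k u v)"
        unfolding sum_kernel_def id[OF uv] using nz[OF uv(1)] by (simp del: complex_cnj_diff)
    qed
  qed
  define s where "s = (\<lambda>n. 1 - 1 / real (n + 2))"
  have s: "0 < s n" "s n < 1" for n by (simp_all add: s_def)
  have slim: "s \<longlonglongrightarrow> 1"
    unfolding s_def
    using tendsto_diff[OF tendsto_const LIMSEQ_ignore_initial_segment[OF lim_1_over_n[where 'a = real], of 2], of 1]
    by simp
  show "psd_kernel (\<lambda>x y. (1 - f x * cnj (f y)) * k x y)"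
  proof (rule psd_kernel_limit[OF scaled[OF s]])
    fix u v :: complex
    have "(\<lambda>n. (1 - of_real (s n) * f u * cnj (of_real (s n) * f v)) * k u v) \<longlonglongrightarrow>
       (1 - of_real 1 * f u * cnj (of_real 1 * f v)) * k u v"
      by (intro tendsto_intros slim)
    then show "(\<lambda>n. (1 - of_real (s n) * f u * cnj (of_real (s n) * f v)) * k u v) \<longlonglongrightarrow>
       (1 - f u * cnj (f v)) * k u v" by simp
  qed
qed

subsection \<open>The Szego kernel without its linear term\<close>

text \<open>The reproducing kernel of the Hardy space functions with derivative \<open>0\<close> at
  the origin.\<close>

definition szego1 :: "complex \<Rightarrow> complex \<Rightarrow> complex" where
  "szego1 x y = 1 / (1 - x * cnj y) - x * cnj y"

lemma norm_mult_cnj_less_1: "norm x < 1 \<Longrightarrow> norm y < 1 \<Longrightarrow> norm (x * cnj y) < 1"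
  using mult_strict_mono'[of "norm x" 1 "norm y" 1] by (simp add: norm_mult)

lemma szego1_sums:
  assumes "norm x < 1" "norm y < 1"
  shows "(\<lambda>n. (if n = 1 then 0 else x ^ n) * cnj (if n = 1 then 0 else y ^ n)) sums szego1 x y"
proof -
  have "(\<lambda>n. (x * cnj y) ^ n - (if n = 1 then x * cnj y else 0)) sums szego1 x y"
    unfolding szego1_def using norm_mult_cnj_less_1[OF assms]
    by (intro sums_diff geometric_sums sums_single)
  moreover have "(\<lambda>n. (x * cnj y) ^ n - (if n = 1 then x * cnj y else 0)) =
      (\<lambda>n. (if n = 1 then 0 else x ^ n) * cnj (if n = 1 then 0 else y ^ n))"
    by (auto simp: power_mult_distrib)
  ultimately show ?thesis by simp
qed

text \<open>The feature map of the kernel consists of the monomials other than \<open>z\<close>, so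
  the form is the sum of the squared moduli of the functional with nodes \<open>x i\<close> and
  weights \<open>c i\<close> on these monomials.\<close>

lemma kernel_form_szego1_sums:
  assumes "\<And>i. i < n \<Longrightarrow> x i \<in> ball 0 1"
  shows "(\<lambda>m. of_real (if m = 1 then 0 else (cmod (\<Sum>i<n. c i * x i ^ m))\<^sup>2)) sums kernel_form szego1 n x c"
proof -
  have "(\<lambda>m. kernel_form (\<lambda>x y. (if m = 1 then 0 else x ^ m) * cnj (if m = 1 then 0 else y ^ m)) n x c)
      sums kernel_form szego1 n x c"
    unfolding kernel_form_def using assms
    by (intro sums_sum sums_mult szego1_sums) auto
  then show ?thesis
    unfolding kernel_form_rank1 by (rule sums_cong[THEN iffD1, rotated]) auto
qed

lemma psd_kernel_szego1: "psd_kernel szego1"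
proof (rule psd_kernelI)
  fix n :: nat and x c :: "nat \<Rightarrow> complex" assume x: "\<And>i. i < n \<Longrightarrow> x i \<in> ball (0::complex) 1"
  note s = kernel_form_szego1_sums[OF x, where c = c]
  let ?t = "\<lambda>m. if m = 1 then 0 else (cmod (\<Sum>i<n. c i * x i ^ m))\<^sup>2"
  have sm: "summable ?t" using sums_summable[OF s] by (simp only: summable_complex_of_real)
  have "kernel_form szego1 n x c = of_real (suminf ?t)"
    using sums_unique[OF s] suminf_of_real[OF sm, where ?'a = complex] by simp
  moreover have "0 \<le> suminf ?t"
    using sm by (rule suminf_nonneg) simp
  ultimately show "kernel_form szego1 n x c \<in> \<real>\<^sub>\<ge>\<^sub>0" by simp
qed

text \<open>Bessel's inequality in \<open>L^2\<close> of the weights \<open>p\<close>: the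
  conjugates of \<open>w\<close> and \<open>w\<^sup>2\<close> are unit vectors, since
  \<open>norm w = 1\<close> and the mass is \<open>1\<close>, and they are orthogonal because the
  barycentre is \<open>0\<close>.\<close>

lemma weighted_bessel:
  fixes v :: "complex \<Rightarrow> complex" and p :: "complex \<Rightarrow> real"
  assumes "finite S" "\<And>w. w \<in> S \<Longrightarrow> 0 \<le> p w" "\<And>w. w \<in> S \<Longrightarrow> norm w = 1"
    and "sum p S = 1" "(\<Sum>w\<in>S. of_real (p w) * w) = 0"
  shows "(cmod (\<Sum>w\<in>S. of_real (p w) * (w * v w)))\<^sup>2 + (cmod (\<Sum>w\<in>S. of_real (p w) * (w\<^sup>2 * v w)))\<^sup>2
     \<le> (\<Sum>w\<in>S. p w * (cmod (v w))\<^sup>2)"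
proof -
  define A where "A = (\<Sum>w\<in>S. of_real (p w) * (w * v w))"
  define B where "B = (\<Sum>w\<in>S. of_real (p w) * (w\<^sup>2 * v w))"
  \<comment> \<open>\<open>A\<close> and \<open>B\<close> are the coefficients of \<open>v\<close>
    against these two vectors, so \<open>d\<close> is the residual; its squared norm is the gap in
    the inequality.\<close>
  define d where "d = (\<lambda>w. v w - A * cnj w - B * (cnj w)\<^sup>2)"
  have sum1: "(\<Sum>w\<in>S. complex_of_real (p w)) = 1" using assms(4) by (simp flip: of_real_sum)
  have ww: "w * cnj w = 1" if "w \<in> S" for w
    using assms(3)[OF that] by (simp add: complex_norm_square[symmetric])
  have mean': "(\<Sum>w\<in>S. of_real (p w) * cnj w) = 0"
    using arg_cong[OF assms(5), of cnj] by simp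
  have "complex_of_real (\<Sum>w\<in>S. p w * (cmod (d w))\<^sup>2) = (\<Sum>w\<in>S. of_real (p w) * (d w * cnj (d w)))"
    by (simp add: complex_norm_square[symmetric])
  also have "\<dots> = (\<Sum>w\<in>S. of_real (p w) * (v w * cnj (v w))
       - cnj A * (of_real (p w) * (w * v w)) - cnj B * (of_real (p w) * (w\<^sup>2 * v w))
       - A * cnj (of_real (p w) * (w * v w)) - B * cnj (of_real (p w) * (w\<^sup>2 * v w))
       + A * cnj A * of_real (p w) + B * cnj B * of_real (p w)
       + A * cnj B * (of_real (p w) * w) + B * cnj A * (of_real (p w) * cnj w))"
  proof (rule sum.cong[OF refl])
    fix w assume w: "w \<in> S"
    define z where "z = cnj w"
    have z: "w * z = 1" using ww[OF w] by (simp add: z_def)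
    have cw: "cnj z = w" by (simp add: z_def)
    show "of_real (p w) * (d w * cnj (d w)) = of_real (p w) * (v w * cnj (v w))
       - cnj A * (of_real (p w) * (w * v w)) - cnj B * (of_real (p w) * (w\<^sup>2 * v w))
       - A * cnj (of_real (p w) * (w * v w)) - B * cnj (of_real (p w) * (w\<^sup>2 * v w))
       + A * cnj A * of_real (p w) + B * cnj B * of_real (p w)
       + A * cnj B * (of_real (p w) * w) + B * cnj A * (of_real (p w) * cnj w)"
      using z by (simp add: d_def cw z_def[symmetric]) algebra
  qed
  also have "\<dots> = (\<Sum>w\<in>S. of_real (p w) * (v w * cnj (v w))) - A * cnj A - B * cnj B"
    unfolding sum.distrib sum_subtractf sum_distrib_left[symmetric] sum1 assms(5) mean'
      cnj_sum[symmetric] A_def[symmetric] B_def[symmetric] by simp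
  also have "\<dots> = of_real ((\<Sum>w\<in>S. p w * (cmod (v w))\<^sup>2) - (cmod A)\<^sup>2 - (cmod B)\<^sup>2)"
    by (simp add: complex_norm_square[symmetric])
  finally have "(\<Sum>w\<in>S. p w * (cmod (d w))\<^sup>2) = (\<Sum>w\<in>S. p w * (cmod (v w))\<^sup>2) - (cmod A)\<^sup>2 - (cmod B)\<^sup>2"
    by (simp only: of_real_eq_iff)
  moreover have "0 \<le> (\<Sum>w\<in>S. p w * (cmod (d w))\<^sup>2)"
    using assms(2) by (intro sum_nonneg) auto
  ultimately show ?thesis by (simp add: A_def B_def)
qed

text \<open>The de Branges--Rovnyak kernel of \<open>psi_theta \<mu>\<close> dominates \<open>1 + x * cnj y\<close> because
  \<open>1\<close> and \<open>z\<close> are the Fourier coefficients of its feature map against two orthonormal vectors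
  of \<open>L\<^sup>2(\<mu>)\<close>.\<close>

lemma psd_kernel_psi_theta:
  assumes \<mu>: "\<mu> \<in> theta_hat"
  shows "psd_kernel (\<lambda>x y. (1 - psi_theta \<mu> x * cnj (psi_theta \<mu> y)) / (1 - x * cnj y) - 1 - x * cnj y)"
proof (rule psd_kernelI)
  fix n :: nat and x c :: "nat \<Rightarrow> complex" assume x: "\<And>i. i < n \<Longrightarrow> x i \<in> ball (0::complex) 1"
  let ?S = "support \<mu>"
  note cen = theta_hat_centered(1)[OF \<mu>]
  note fin = centered_finite[OF cen]
  have sum1: "(\<Sum>w\<in>?S. complex_of_real (\<mu> w)) = 1"
    using theta_hat_centered(2)[OF \<mu>] by (simp flip: of_real_sum)
  \<comment> \<open>Feature map of the de Branges-Rovnyak kernel in \<open>L^2\<close> of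
    \<open>\<mu>\<close>; the \<open>2\<close> is the square root of the product of the factors in
    \<open>cayley_transform_kernel\<close> and \<open>herglotz_kernel\<close>.\<close>
  define G where "G = (\<lambda>w z. 2 / ((w - z) * (herglotz \<mu> z + 1)))"
  have wz: "w - z \<noteq> 0" if "w \<in> ?S" "z \<in> ball 0 1" for w z
    using ball_not_in_support[OF cen that(2)] that(1) by auto
  \<comment> \<open>This rests on \<open>2 * w / (w - z) = (w + z) / (w - z) + 1\<close> and on the
    total mass being \<open>1\<close>.\<close>
  have G1: "(\<Sum>w\<in>?S. of_real (\<mu> w) * (w * G w z)) = 1" if z: "z \<in> ball 0 1" for z
  proof -
    have "2 * (\<Sum>w\<in>?S. of_real (\<mu> w) * (w / (w - z))) = (\<Sum>w\<in>?S. of_real (\<mu> w) * ((w + z) / (w - z)) + of_real (\<mu> w))"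
      unfolding sum_distrib_left using wz[OF _ z] by (intro sum.cong) (auto simp: field_simps)
    then have *: "2 * (\<Sum>w\<in>?S. of_real (\<mu> w) * (w / (w - z))) = herglotz \<mu> z + 1"
      by (simp add: sum.distrib sum1 herglotz_support)
    have "(\<Sum>w\<in>?S. of_real (\<mu> w) * (w * G w z)) = 2 * (\<Sum>w\<in>?S. of_real (\<mu> w) * (w / (w - z))) / (herglotz \<mu> z + 1)"
      unfolding sum_distrib_left sum_divide_distrib by (intro sum.cong) (auto simp: G_def)
    then show ?thesis using * herglotz_plus_1_nonzero[OF cen z] by simp
  qed
  \<comment> \<open>Writing one factor \<open>w\<close> as \<open>z + (w - z)\<close> splits off
    \<open>z\<close> times \<open>G1\<close>; the remainder is a multiple of the barycentre and
    vanishes.\<close>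
  have G2: "(\<Sum>w\<in>?S. of_real (\<mu> w) * (w\<^sup>2 * G w z)) = z" if z: "z \<in> ball 0 1" for z
  proof -
    have "w\<^sup>2 * G w z = z * (w * G w z) + w * (2 / (herglotz \<mu> z + 1))" if "w \<in> ?S" for w
    proof -
      have "G w z * (w - z) = 2 / (herglotz \<mu> z + 1)"
        unfolding G_def times_divide_eq_left mult.commute[of "w - z"]
        by (rule mult_divide_mult_cancel_right[OF wz[OF that z]])
      then have "w * (2 / (herglotz \<mu> z + 1)) = w * (G w z * (w - z))" by simp
      then show ?thesis by (simp add: algebra_simps power2_eq_square)
    qed
    then have "(\<Sum>w\<in>?S. of_real (\<mu> w) * (w\<^sup>2 * G w z)) =
       (\<Sum>w\<in>?S. z * (of_real (\<mu> w) * (w * G w z)) + of_real (\<mu> w) * w * (2 / (herglotz \<mu> z + 1)))"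
      by (intro sum.cong) (auto simp: algebra_simps)
    also have "\<dots> = z"
      unfolding sum.distrib sum_distrib_left[symmetric] sum_distrib_right[symmetric] G1[OF z] centered_mean[OF cen]
      by simp
    finally show ?thesis .
  qed
  define v where "v = (\<lambda>w. \<Sum>i<n. c i * G w (x i))"
  have A: "(\<Sum>w\<in>?S. of_real (\<mu> w) * (w * v w)) = (\<Sum>i<n. c i * 1)"
  proof -
    have "(\<Sum>w\<in>?S. of_real (\<mu> w) * (w * v w)) = (\<Sum>i<n. c i * (\<Sum>w\<in>?S. of_real (\<mu> w) * (w * G w (x i))))"
      unfolding v_def sum_distrib_left by (subst sum.swap) (simp add: mult_ac)
    then show ?thesis using G1 x by simp
  qed
  have B: "(\<Sum>w\<in>?S. of_real (\<mu> w) * (w\<^sup>2 * v w)) = (\<Sum>i<n. c i * x i)"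
  proof -
    have "(\<Sum>w\<in>?S. of_real (\<mu> w) * (w\<^sup>2 * v w)) = (\<Sum>i<n. c i * (\<Sum>w\<in>?S. of_real (\<mu> w) * (w\<^sup>2 * G w (x i))))"
      unfolding v_def sum_distrib_left by (subst sum.swap) (simp add: mult_ac)
    then show ?thesis using G2 x by simp
  qed
  let ?D = "\<lambda>x y. \<Sum>w\<in>?S. of_real (\<mu> w) * (G w x * cnj (G w y))"
  have D: "(1 - psi_theta \<mu> u * cnj (psi_theta \<mu> v)) / (1 - u * cnj v) = ?D u v"
    if u: "u \<in> ball 0 1" and v: "v \<in> ball 0 1" for u v
  proof -
    let ?a = "herglotz \<mu> u" and ?b = "herglotz \<mu> v"
    note nz = herglotz_plus_1_nonzero[OF cen u] herglotz_plus_1_nonzero[OF cen v]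
    have nzb: "cnj (?b + 1) \<noteq> 0" using nz(2) by (simp del: complex_cnj_add)
    have cross: "X / r = Y / p" if "p \<noteq> 0" "r \<noteq> 0" "p * X = r * Y" for X Y p r :: complex
      using that by (simp add: field_simps)
    have uv: "1 - u * cnj v \<noteq> 0" using norm_mult_cnj_less_1[of u v] u v by auto
    have "(?a + 1) * cnj (?b + 1) * (1 - psi_theta \<mu> u * cnj (psi_theta \<mu> v)) = 2 * (?a + cnj ?b)"
      unfolding psi_theta_def by (rule cayley_transform_kernel[OF nz])
    also have "\<dots> = (1 - u * cnj v) * (4 * (\<Sum>w\<in>?S. of_real (\<mu> w) * (1 / (w - u) * cnj (1 / (w - v)))))"
      by (subst herglotz_kernel[OF cen ball_not_in_support[OF cen u] ball_not_in_support[OF cen v]]) simp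
    finally have "(1 - psi_theta \<mu> u * cnj (psi_theta \<mu> v)) / (1 - u * cnj v) =
       4 * (\<Sum>w\<in>?S. of_real (\<mu> w) * (1 / (w - u) * cnj (1 / (w - v)))) / ((?a + 1) * cnj (?b + 1))"
      using cross[of "(?a + 1) * cnj (?b + 1)", OF _ uv] nz(1) nzb by (simp del: complex_cnj_add)
    also have "\<dots> = ?D u v"
      unfolding sum_distrib_left sum_divide_distrib by (intro sum.cong) (auto simp: G_def mult_ac)
    finally show ?thesis .
  qed
  have "kernel_form (\<lambda>x y. (1 - psi_theta \<mu> x * cnj (psi_theta \<mu> y)) / (1 - x * cnj y) - 1 - x * cnj y) n x c
     = kernel_form (\<lambda>x y. ?D x y - (1 * cnj 1) - x * cnj y) n x c"
    by (rule kernel_form_cong[OF x]) (auto simp: D)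
  also have "\<dots> = kernel_form ?D n x c - kernel_form (\<lambda>x y. 1 * cnj 1) n x c - kernel_form (\<lambda>x y. x * cnj y) n x c"
    unfolding kernel_form_def by (simp only: right_diff_distrib sum_subtractf)
  also have "kernel_form ?D n x c = of_real (\<Sum>w\<in>?S. \<mu> w * (cmod (v w))\<^sup>2)"
  proof -
    have "kernel_form ?D n x c = (\<Sum>w\<in>?S. of_real (\<mu> w) * kernel_form (\<lambda>x y. G w x * cnj (G w y)) n x c)"
    proof -
      have "kernel_form ?D n x c = (\<Sum>i<n. \<Sum>j<n. \<Sum>w\<in>?S. c i * cnj (c j) * (of_real (\<mu> w) * (G w (x i) * cnj (G w (x j)))))"
        by (simp add: kernel_form_def sum_distrib_left)
      also have "\<dots> = (\<Sum>i<n. \<Sum>w\<in>?S. \<Sum>j<n. c i * cnj (c j) * (of_real (\<mu> w) * (G w (x i) * cnj (G w (x j)))))"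
        by (intro sum.cong sum.swap refl)
      also have "\<dots> = (\<Sum>w\<in>?S. \<Sum>i<n. \<Sum>j<n. c i * cnj (c j) * (of_real (\<mu> w) * (G w (x i) * cnj (G w (x j)))))"
        by (rule sum.swap)
      finally show ?thesis by (simp add: kernel_form_def sum_distrib_left mult_ac)
    qed
    then show ?thesis by (simp add: kernel_form_rank1 v_def)
  qed
  also have "\<dots> - kernel_form (\<lambda>x y. 1 * cnj 1) n x c - kernel_form (\<lambda>x y. x * cnj y) n x c =
     of_real ((\<Sum>w\<in>?S. \<mu> w * (cmod (v w))\<^sup>2) - (cmod (\<Sum>i<n. c i * 1))\<^sup>2 - (cmod (\<Sum>i<n. c i * x i))\<^sup>2)"
    unfolding kernel_form_rank1 by simp
  finally have eq: "kernel_form (\<lambda>x y. (1 - psi_theta \<mu> x * cnj (psi_theta \<mu> y)) / (1 - x * cnj y) - 1 - x * cnj y) n x c =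
     of_real ((\<Sum>w\<in>?S. \<mu> w * (cmod (v w))\<^sup>2) - (cmod (\<Sum>i<n. c i * 1))\<^sup>2 - (cmod (\<Sum>i<n. c i * x i))\<^sup>2)" .
  have "(cmod (\<Sum>i<n. c i * 1))\<^sup>2 + (cmod (\<Sum>i<n. c i * x i))\<^sup>2 \<le> (\<Sum>w\<in>?S. \<mu> w * (cmod (v w))\<^sup>2)"
    unfolding A[symmetric] B[symmetric]
    using fin centered_nonneg[OF cen] centered_sphere[OF cen] theta_hat_centered(2)[OF \<mu>] centered_mean[OF cen]
    by (intro weighted_bessel) auto
  then show "kernel_form (\<lambda>x y. (1 - psi_theta \<mu> x * cnj (psi_theta \<mu> y)) / (1 - x * cnj y) - 1 - x * cnj y) n x c \<in> \<real>\<^sub>\<ge>\<^sub>0"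
    unfolding eq nonneg_Reals_of_real_iff by simp
qed

text \<open>With \<open>p = psi_theta \<mu>\<close>, removing the linear term from the Szego kernel
  subtracts \<open>x * cnj y * (1 - p x * cnj (p y))\<close>. The part \<open>- x * cnj y\<close> is
  absorbed by \<open>psd_kernel_psi_theta\<close>; what remains, \<open>1\<close> and
  \<open>x * p x * cnj (y * p y)\<close>, has rank one each.\<close>

lemma szego1_in_K_Psi: "szego1 \<in> K_Psi Psi_set"
  unfolding K_Psi_Psi_set_iff
proof (intro conjI ballI psd_kernel_szego1)
  fix \<mu> assume \<mu>: "\<mu> \<in> theta_hat"
  let ?p = "psi_theta \<mu>"
  have "psd_kernel (\<lambda>x y. ((1 - ?p x * cnj (?p y)) / (1 - x * cnj y) - 1 - x * cnj y)
      + (1 * cnj 1 + (x * ?p x) * cnj (y * ?p y)))"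
    by (intro psd_kernel_add psd_kernel_psi_theta[OF \<mu>] psd_kernel_rank1)
  then show "psd_kernel (\<lambda>x y. (1 - ?p x * cnj (?p y)) * szego1 x y)"
    by (rule psd_kernel_cong) (simp add: szego1_def diff_divide_distrib algebra_simps)
qed

section \<open>Boundedness and regularity forced by contractivity\<close>

text \<open>Since \<open>szego1 x y - 1\<close> is positive semidefinite, contractivity against
  \<open>szego1\<close> implies that \<open>szego1 x y - f x * cnj (f y)\<close> is too. Hence a
  finite combination of values of \<open>f\<close> is bounded by the square-sum of the same
  combinations for the monomials other than \<open>z\<close>.\<close>

lemma Hinf_K_ball_szego1_bound:
  fixes x c :: "nat \<Rightarrow> complex" and n :: nat
  assumes f: "f \<in> Hinf_K_ball Psi_set" and x: "\<And>i. i < n \<Longrightarrow> x i \<in> ball 0 1"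
    and B: "\<And>m. m \<noteq> 1 \<Longrightarrow> cmod (\<Sum>i<n. c i * x i ^ m) \<le> B m"
    and sB: "summable (\<lambda>m. (B m)\<^sup>2)"
  shows "(cmod (\<Sum>i<n. c i * f (x i)))\<^sup>2 \<le> (\<Sum>m. (B m)\<^sup>2)"
proof -
  have psd: "psd_kernel (\<lambda>x y. szego1 x y - f x * cnj (f y))"
  proof -
    have "psd_kernel (\<lambda>x y. szego1 x y - 1)"
    proof (rule psd_kernel_limit)
      show "psd_kernel (\<lambda>x y. \<Sum>m\<in>{2..<N}. x ^ m * cnj (y ^ m))" for N :: nat
        by (intro psd_kernel_sum psd_kernel_rank1)
      fix u v :: complex assume uv: "u \<in> ball 0 1" "v \<in> ball 0 1"
      let ?t = "\<lambda>n. (if n = 1 then 0 else u ^ n) * cnj (if n = 1 then 0 else v ^ n)"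
      have "(\<lambda>N. (\<Sum>m<N. ?t m) - 1) \<longlonglongrightarrow> szego1 u v - 1"
        using szego1_sums[of u v] uv unfolding sums_def by (intro tendsto_intros) auto
      then show "(\<lambda>N. \<Sum>m\<in>{2..<N}. u ^ m * cnj (v ^ m)) \<longlonglongrightarrow> szego1 u v - 1"
      proof (rule Lim_transform_eventually)
        show "\<forall>\<^sub>F N in sequentially. (\<Sum>m<N. ?t m) - 1 = (\<Sum>m\<in>{2..<N}. u ^ m * cnj (v ^ m))"
          using eventually_ge_at_top[of 2]
        proof eventually_elim
          case (elim N)
          have "(\<Sum>m<N. ?t m) = sum ?t {..<2} + sum ?t {2..<N}"
            using sum.atLeastLessThan_concat[of 0 2 N ?t] elim by (simp add: lessThan_atLeast0)
          moreover have "sum ?t {..<2} = 1" by (simp add: numeral_2_eq_2)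
          ultimately show ?case by (auto intro!: sum.cong)
        qed
      qed
    qed
    then have "psd_kernel (\<lambda>x y. (1 - f x * cnj (f y)) * szego1 x y + f x * cnj (f y) * (szego1 x y - 1))"
      using f szego1_in_K_Psi unfolding Hinf_K_ball_def
      by (intro psd_kernel_add psd_kernel_conjugate) auto
    then show ?thesis by (rule psd_kernel_cong) (simp add: algebra_simps)
  qed
  have "kernel_form (\<lambda>x y. szego1 x y - f x * cnj (f y)) n x c =
      kernel_form szego1 n x c - kernel_form (\<lambda>x y. f x * cnj (f y)) n x c"
    unfolding kernel_form_def by (simp only: right_diff_distrib sum_subtractf)
  moreover have "kernel_form (\<lambda>x y. szego1 x y - f x * cnj (f y)) n x c \<in> \<real>\<^sub>\<ge>\<^sub>0"
    by (rule psd_kernelD[OF psd x])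
  ultimately have "(cmod (\<Sum>i<n. c i * f (x i)))\<^sup>2 \<le> Re (kernel_form szego1 n x c)"
    unfolding kernel_form_rank1 complex_nonneg_Reals_iff by (simp flip: of_real_power)
  also have "\<dots> \<le> (\<Sum>m. (B m)\<^sup>2)"
  proof (rule sums_le)
    show "(\<lambda>m. if m = 1 then 0 else (cmod (\<Sum>i<n. c i * x i ^ m))\<^sup>2) sums Re (kernel_form szego1 n x c)"
      using sums_Re[OF kernel_form_szego1_sums[OF x]] by simp
    show "(\<lambda>m. (B m)\<^sup>2) sums (\<Sum>m. (B m)\<^sup>2)" using sB by (rule summable_sums)
    show "(if m = 1 then 0 else (cmod (\<Sum>i<n. c i * x i ^ m))\<^sup>2) \<le> (B m)\<^sup>2" for m
      using B[of m] by (auto intro: power_mono)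
  qed
  finally show ?thesis .
qed

text \<open>On the diagonal \<open>szego1 z z\<close> is positive, so positivity of the product
  decides the sign of \<open>1 - (norm (f z))\<^sup>2\<close>.\<close>

lemma Hinf_K_ball_norm_le_1:
  assumes f: "f \<in> Hinf_K_ball Psi_set" and z: "z \<in> ball 0 1"
  shows "norm (f z) \<le> 1"
proof -
  have "(1 - f z * cnj (f z)) * szego1 z z \<in> \<real>\<^sub>\<ge>\<^sub>0"
    using psd_kernel_diag[of "\<lambda>x y. (1 - f x * cnj (f y)) * szego1 x y" z] f z szego1_in_K_Psi
    unfolding Hinf_K_ball_def by auto
  moreover have "(1 - f z * cnj (f z)) * szego1 z z =
      of_real ((1 - (norm (f z))\<^sup>2) * (1 / (1 - (norm z)\<^sup>2) - (norm z)\<^sup>2))"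
    unfolding szego1_def complex_norm_square[symmetric] by simp
  ultimately have "0 \<le> (1 - (norm (f z))\<^sup>2) * (1 / (1 - (norm z)\<^sup>2) - (norm z)\<^sup>2)"
    by (simp only: nonneg_Reals_of_real_iff)
  moreover have "(norm z)\<^sup>2 < 1 / (1 - (norm z)\<^sup>2)"
  proof -
    have z2: "(norm z)\<^sup>2 < 1" using z by (simp add: power_less_one_iff)
    then have "1 \<le> 1 / (1 - (norm z)\<^sup>2)" by simp
    then show ?thesis using z2 by linarith
  qed
  ultimately have "(norm (f z))\<^sup>2 \<le> 1"
    by (simp add: zero_le_mult_iff)
  then show ?thesis by (simp add: power_le_one_iff abs_square_le_1)
qed

text \<open>The constant in \<open>lemma_termdiff3\<close>, the second-order Taylor estimate for
  \<open>z ^ n\<close> on the disc of radius \<open>K\<close>; it is \<open>0\<close> for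
  \<open>n = 0\<close> and \<open>n = 1\<close>.\<close>

definition quotient_bound :: "real \<Rightarrow> nat \<Rightarrow> real" where
  "quotient_bound K n = real n * real (n - Suc 0) * K ^ (n - 2)"

text \<open>Differentiating the geometric series twice gives summability of the bounds themselves;
  being eventually below \<open>1\<close>, they dominate their squares.\<close>

lemma summable_quotient_bound_square:
  assumes "0 < K" "K < 1"
  shows "summable (\<lambda>n. (quotient_bound K n)\<^sup>2)"
proof -
  have 0: "summable (\<lambda>n. 1 * x ^ n)" if "norm x < 1" for x :: real
    using that by (simp add: summable_geometric)
  have 1: "summable (\<lambda>n. diffs (\<lambda>n. 1) n * x ^ n)" if "norm x < 1" for x :: real
    using that 0 by (rule termdiff_converges)
  have "summable (\<lambda>n. diffs (diffs (\<lambda>n. 1)) n * K ^ n)"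
    by (rule termdiff_converges[of K 1]) (use 1 assms in auto)
  moreover have "diffs (diffs (\<lambda>n. 1)) n * K ^ n = quotient_bound K (n + 2)" for n
    by (simp add: diffs_def quotient_bound_def)
  ultimately have "summable (\<lambda>n. quotient_bound K (n + 2))" by simp
  then have s: "summable (quotient_bound K)" by (simp only: summable_iff_shift)
  have nn: "0 \<le> quotient_bound K n" for n using assms by (simp add: quotient_bound_def)
  have "\<forall>\<^sub>F n in sequentially. quotient_bound K n < 1"
    using summable_LIMSEQ_zero[OF s] by (rule order_tendstoD) simp
  then have "\<forall>\<^sub>F n in sequentially. norm ((quotient_bound K n)\<^sup>2) \<le> quotient_bound K n"
  proof eventually_elim
    case (elim n)
    then show ?case using nn[of n] mult_left_le[of "quotient_bound K n" "quotient_bound K n"]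
      by (simp add: power2_eq_square)
  qed
  then show ?thesis using s by (rule summable_comparison_test_ev)
qed

lemma has_field_derivative_of_quotient_bound:
  fixes f :: "complex \<Rightarrow> complex"
  assumes "0 < \<delta>"
    and "\<And>h. h \<noteq> 0 \<Longrightarrow> norm h < \<delta> \<Longrightarrow> norm ((f (x + h) - f x) / h - L) \<le> C * norm h"
  shows "(f has_field_derivative L) (at x)"
  unfolding DERIV_def
proof (subst LIM_zero_iff[symmetric], rule tendsto_norm_zero_cancel, rule tendsto_0_le)
  show "((\<lambda>h :: complex. h) \<longlongrightarrow> 0) (at 0)" by (rule tendsto_ident_at)
  show "\<forall>\<^sub>F h in at 0. norm (norm ((f (x + h) - f x) / h - L)) \<le> norm h * C"
    unfolding eventually_at using assms by (intro exI[of _ \<delta>]) (auto simp: mult.commute)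
qed

text \<open>With no candidate for the derivative at hand, it is produced as a limit of quotients
  along one sequence; letting one increment tend to \<open>0\<close> in the hypothesis then gives
  the rate for every other.\<close>

lemma differentiable_of_quotients_Cauchy:
  fixes f :: "complex \<Rightarrow> complex"
  assumes \<delta>: "0 < \<delta>" and C: "0 \<le> C"
    and q: "\<And>h h'. h \<noteq> 0 \<Longrightarrow> h' \<noteq> 0 \<Longrightarrow> norm h < \<delta> \<Longrightarrow> norm h' < \<delta> \<Longrightarrow>
        norm ((f (x + h) - f x) / h - (f (x + h') - f x) / h') \<le> C * (norm h + norm h')"
  shows "f field_differentiable at x"
proof -
  let ?q = "\<lambda>h. (f (x + h) - f x) / h"
  \<comment> \<open>The shift by \<open>2\<close> makes \<open>norm (s n) < \<delta>\<close> strict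
    already at \<open>n = 0\<close>.\<close>
  define s where "s = (\<lambda>n. complex_of_real (\<delta> * (1 / real (n + 2))))"
  have s: "s n \<noteq> 0" "norm (s n) < \<delta>" "norm (s n) = \<delta> * (1 / real (n + 2))" for n
    using \<delta> unfolding s_def norm_of_real of_real_eq_0_iff
    by (simp_all add: field_simps add_pos_nonneg)
  have ns: "(\<lambda>n. norm (s n)) \<longlonglongrightarrow> 0"
    unfolding s(3)
    using tendsto_mult[OF tendsto_const LIMSEQ_ignore_initial_segment[OF lim_1_over_n[where 'a = real], of 2], of \<delta>]
    by simp
  have "Cauchy (\<lambda>n. ?q (s n))"
  proof (rule metric_CauchyI)
    fix e :: real assume "0 < e"
    have "(\<lambda>n. C * norm (s n)) \<longlonglongrightarrow> C * 0" by (intro tendsto_intros ns)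
    then have "\<forall>\<^sub>F n in sequentially. C * norm (s n) < e / 2"
      using \<open>0 < e\<close> by (intro order_tendstoD) auto
    then obtain N where N: "\<And>n. n \<ge> N \<Longrightarrow> C * norm (s n) < e / 2"
      by (auto simp: eventually_sequentially)
    have "dist (?q (s m)) (?q (s n)) < e" if "m \<ge> N" "n \<ge> N" for m n
      using q[OF s(1) s(1) s(2) s(2), of m n] N[OF that(1)] N[OF that(2)]
      by (simp add: dist_norm distrib_left)
    then show "\<exists>N. \<forall>m\<ge>N. \<forall>n\<ge>N. dist (?q (s m)) (?q (s n)) < e" by blast
  qed
  then obtain L where L: "(\<lambda>n. ?q (s n)) \<longlonglongrightarrow> L"
    by (meson Cauchy_convergent convergent_def)
  have "norm (?q h - L) \<le> C * norm h" if h: "h \<noteq> 0" "norm h < \<delta>" for h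
  proof -
    have "(\<lambda>n. norm (?q h - ?q (s n))) \<longlonglongrightarrow> norm (?q h - L)"
      by (intro tendsto_intros L)
    moreover have "(\<lambda>n. C * (norm h + norm (s n))) \<longlonglongrightarrow> C * (norm h + 0)"
      by (intro tendsto_intros ns)
    ultimately have "norm (?q h - L) \<le> C * (norm h + 0)"
      using q[OF h(1) s(1) h(2) s(2)] by (intro LIMSEQ_le) auto
    then show ?thesis by simp
  qed
  then have "(f has_field_derivative L) (at x)"
    using \<delta> by (intro has_field_derivative_of_quotient_bound) auto
  then show ?thesis unfolding field_differentiable_def by blast
qed

text \<open>A difference of two quotients combines three values of \<open>f\<close>; on
  \<open>z ^ m\<close> both quotients are close to \<open>m * x ^ (m - 1)\<close>, which cancels. At
  the origin one quotient suffices: \<open>m * 0 ^ (m - 1)\<close> is \<open>0\<close> for every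
  \<open>m\<close> except \<open>1\<close>, the one monomial missing from the kernel.\<close>

lemma Hinf_K_ball_quotient_bounds:
  assumes f: "f \<in> Hinf_K_ball Psi_set" and K: "0 < K" "K < 1" and x: "norm x \<le> K"
  defines "C \<equiv> sqrt (\<Sum>m. (quotient_bound K m)\<^sup>2)"
  shows "h \<noteq> 0 \<Longrightarrow> h' \<noteq> 0 \<Longrightarrow> norm (x + h) \<le> K \<Longrightarrow> norm (x + h') \<le> K \<Longrightarrow>
      norm ((f (x + h) - f x) / h - (f (x + h') - f x) / h') \<le> C * (norm h + norm h')"
    and "h \<noteq> 0 \<Longrightarrow> norm h \<le> K \<Longrightarrow> norm ((f h - f 0) / h) \<le> C * norm h"
proof -
  note sq = summable_quotient_bound_square[OF K]
  have C2: "C\<^sup>2 = (\<Sum>m. (quotient_bound K m)\<^sup>2)" and C0: "0 \<le> C"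
    unfolding C_def using sq by (auto intro!: suminf_nonneg)
  have sqt: "summable (\<lambda>m. (quotient_bound K m * t)\<^sup>2)"
    and sumt: "(\<Sum>m. (quotient_bound K m * t)\<^sup>2) = (C * t)\<^sup>2" for t
    unfolding power_mult_distrib C2 using sq by (auto intro: summable_mult2 simp: suminf_mult2)
  {
    assume h: "h \<noteq> 0" "h' \<noteq> 0" "norm (x + h) \<le> K" "norm (x + h') \<le> K"
    define p where "p = (\<lambda>i :: nat. if i = 0 then x + h else if i = 1 then x + h' else x)"
    define c where "c = (\<lambda>i :: nat. if i = 0 then 1 / h else if i = 1 then - 1 / h' else 1 / h' - 1 / h)"
    have eq: "(\<Sum>i<3. c i * g (p i)) = (g (x + h) - g x) / h - (g (x + h') - g x) / h'" for g
      by (simp add: numeral_3_eq_3 p_def c_def diff_divide_distrib algebra_simps)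
    have "(cmod (\<Sum>i<3. c i * f (p i)))\<^sup>2 \<le> (\<Sum>m. (quotient_bound K m * (norm h + norm h'))\<^sup>2)"
    proof (rule Hinf_K_ball_szego1_bound[OF f _ _ sqt])
      show "p i \<in> ball 0 1" for i using K x h by (auto simp: p_def)
      fix m :: nat
      let ?d = "of_nat m * x ^ (m - Suc 0)"
      have "norm (((x + h) ^ m - x ^ m) / h - ?d) \<le> quotient_bound K m * norm h"
           "norm (((x + h') ^ m - x ^ m) / h' - ?d) \<le> quotient_bound K m * norm h'"
        using lemma_termdiff3[OF h(1) x h(3), of m] lemma_termdiff3[OF h(2) x h(4), of m]
        by (simp_all add: quotient_bound_def)
      then show "cmod (\<Sum>i<3. c i * p i ^ m) \<le> quotient_bound K m * (norm h + norm h')"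
        unfolding eq[of "\<lambda>z. z ^ m"] distrib_left
        using norm_triangle_ineq4[of "((x + h) ^ m - x ^ m) / h - ?d" "((x + h') ^ m - x ^ m) / h' - ?d"]
        by simp
    qed
    then show "norm ((f (x + h) - f x) / h - (f (x + h') - f x) / h') \<le> C * (norm h + norm h')"
      unfolding eq sumt by (rule power2_le_imp_le) (use C0 in simp)
  }
  {
    assume h: "h \<noteq> 0" "norm h \<le> K"
    define p where "p = (\<lambda>i :: nat. if i = 0 then h else 0)"
    define c where "c = (\<lambda>i :: nat. if i = 0 then 1 / h else - 1 / h)"
    have eq: "(\<Sum>i<2. c i * g (p i)) = (g h - g 0) / h" for g
      by (simp add: numeral_2_eq_2 p_def c_def diff_divide_distrib algebra_simps)
    have "(cmod (\<Sum>i<2. c i * f (p i)))\<^sup>2 \<le> (\<Sum>m. (quotient_bound K m * norm h)\<^sup>2)"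
    proof (rule Hinf_K_ball_szego1_bound[OF f _ _ sqt])
      show "p i \<in> ball 0 1" for i using K h by (auto simp: p_def)
      fix m :: nat assume m: "m \<noteq> 1"
      have d0: "of_nat m * (0 :: complex) ^ (m - Suc 0) = 0"
        using m by (cases m) auto
      show "cmod (\<Sum>i<2. c i * p i ^ m) \<le> quotient_bound K m * norm h"
        unfolding eq[of "\<lambda>z. z ^ m"]
        using lemma_termdiff3[of h 0 K m, OF h(1)] h(2) K d0 by (simp add: quotient_bound_def)
    qed
    then show "norm ((f h - f 0) / h) \<le> C * norm h"
      unfolding eq sumt by (rule power2_le_imp_le) (use C0 in simp)
  }
qed

lemma Hinf_K_ball_holomorphic:
  assumes f: "f \<in> Hinf_K_ball Psi_set"
  shows "f holomorphic_on ball 0 1" "deriv f 0 = 0"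
proof -
  have "f field_differentiable at x" if "x \<in> ball 0 1" for x
  proof -
    \<comment> \<open>The midpoint between \<open>norm x\<close> and \<open>1\<close> leaves room
      for increments below \<open>K - norm x\<close>.\<close>
    define K where "K = (norm x + 1) / 2"
    have K: "0 < K" "K < 1" "norm x < K"
      using that norm_ge_zero[of x] unfolding K_def by (auto simp: field_simps intro: add_pos_nonneg)
    have le: "norm (x + h) \<le> K" if "norm h < K - norm x" for h
      using that norm_triangle_ineq[of x h] by simp
    show ?thesis
    proof (rule differentiable_of_quotients_Cauchy)
      show "0 < K - norm x" using K by simp
      show "0 \<le> sqrt (\<Sum>m. (quotient_bound K m)\<^sup>2)"
        using summable_quotient_bound_square[OF K(1,2)] by (auto intro: suminf_nonneg)
    qed (use Hinf_K_ball_quotient_bounds(1)[OF f K(1,2), of x] K le in auto)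
  qed
  then show "f holomorphic_on ball 0 1"
    unfolding holomorphic_on_def using field_differentiable_at_within by blast
  have "(f has_field_derivative 0) (at 0)"
  proof (rule has_field_derivative_of_quotient_bound)
    show "(0 :: real) < 1 / 2" by simp
    show "norm ((f (0 + h) - f 0) / h - 0) \<le> sqrt (\<Sum>m. (quotient_bound (1 / 2) m)\<^sup>2) * norm h"
      if "h \<noteq> 0" "norm h < 1 / 2" for h
      using Hinf_K_ball_quotient_bounds(2)[OF f, of "1 / 2" 0 h] that by simp
  qed
  then show "deriv f 0 = 0" by (rule DERIV_imp_deriv)
qed

lemma Hinf_K_ball_Psi_set:
  "f \<in> Hinf_K_ball Psi_set \<longleftrightarrow>
     f holomorphic_on ball 0 1 \<and> deriv f 0 = 0 \<and> (\<forall>z\<in>ball 0 1. norm (f z) \<le> 1)"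
  using Hinf_K_ball_PsiI Hinf_K_ball_holomorphic Hinf_K_ball_norm_le_1 by blast

section \<open>From the unit ball to the space and its norm\<close>

lemma scale_in_Hinf_1:
  assumes "f holomorphic_on ball 0 1" "deriv f 0 = 0"
  shows "(\<lambda>z. c * f z) holomorphic_on ball 0 1" "deriv (\<lambda>z. c * f z) 0 = 0"
proof -
  show "(\<lambda>z. c * f z) holomorphic_on ball 0 1" using assms(1) by (intro holomorphic_intros)
  have "f field_differentiable at 0"
    using assms(1) by (rule holomorphic_on_imp_differentiable_at) auto
  then show "deriv (\<lambda>z. c * f z) 0 = 0" using assms(2) by simp
qed

theorem mainTheorem7:
  shows "Hinf_K Psi_set = Hinf_1 \<and> (\<forall>f\<in>Hinf_1. Hinf_K_norm Psi_set f = sup_norm f)"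
proof (intro conjI ballI)
  have scaled: "(\<lambda>z. f z / of_real t) \<in> Hinf_K_ball Psi_set \<longleftrightarrow> (\<forall>z\<in>ball 0 1. norm (f z) \<le> t)"
    if f: "f \<in> Hinf_1" and t: "0 < t" for f t
  proof -
    have "(\<lambda>z. f z / of_real t) holomorphic_on ball 0 1" "deriv (\<lambda>z. f z / of_real t) 0 = 0"
      using scale_in_Hinf_1[of f "1 / of_real t"] f by (auto simp: Hinf_1_def)
    then show ?thesis
      unfolding Hinf_K_ball_Psi_set using t by (simp add: norm_divide)
  qed
  show "Hinf_K Psi_set = Hinf_1"
  proof (intro equalityI subsetI)
    fix f assume "f \<in> Hinf_K Psi_set"
    then obtain t g where g: "g \<in> Hinf_K_ball Psi_set" "f = (\<lambda>z. t * g z)"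
      unfolding Hinf_K_def by blast
    have "norm (f z) \<le> norm t" if "z \<in> ball 0 1" for z
      using g(1) that mult_left_mono[of "norm (g z)" 1 "norm t"]
      unfolding g(2) Hinf_K_ball_Psi_set by (simp add: norm_mult)
    then have "bounded (f ` ball 0 1)" by (intro boundedI[of _ "norm t"]) auto
    then show "f \<in> Hinf_1"
      using g(1) unfolding g(2) Hinf_K_ball_Psi_set Hinf_1_def by (auto simp: scale_in_Hinf_1)
  next
    fix f assume f: "f \<in> Hinf_1"
    then have "bounded (f ` ball 0 1)" by (simp add: Hinf_1_def)
    then obtain M where M: "0 < M" "\<forall>z\<in>ball 0 1. norm (f z) \<le> M"
      by (auto simp: bounded_pos)
    then have "(\<lambda>z. f z / of_real M) \<in> Hinf_K_ball Psi_set" using scaled[OF f] by blast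
    moreover have "f = (\<lambda>z. of_real M * (f z / of_real M))" using M(1) by auto
    ultimately show "f \<in> Hinf_K Psi_set" unfolding Hinf_K_def by blast
  qed
  fix f assume f: "f \<in> Hinf_1"
  have bdd: "bdd_above ((\<lambda>z. norm (f z)) ` ball 0 1)"
    using f unfolding Hinf_1_def by (auto simp: bounded_iff bdd_above_def)
  have sup: "(\<forall>z\<in>ball 0 1. norm (f z) \<le> t) \<longleftrightarrow> sup_norm f \<le> t" for t
    unfolding sup_norm_def using bdd by (subst cSUP_le_iff) auto
  have nn: "0 \<le> sup_norm f"
    using sup[of "sup_norm f"] by (auto intro: order_trans[OF norm_ge_zero[of "f 0"]])
  have set: "{t. t > 0 \<and> (\<lambda>z. f z / of_real t) \<in> Hinf_K_ball Psi_set} = {t. t > 0 \<and> sup_norm f \<le> t}"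
    using scaled[OF f] sup by auto
  show "Hinf_K_norm Psi_set f = sup_norm f"
    unfolding Hinf_K_norm_def set
  proof (rule cInf_eq)
    fix y assume y: "\<And>t. t \<in> {t. t > 0 \<and> sup_norm f \<le> t} \<Longrightarrow> y \<le> t"
    \<comment> \<open>If \<open>f\<close> vanishes on the disc, \<open>sup_norm f\<close> is not
      itself an admissible \<open>t > 0\<close>, so \<open>y\<close> is compared with
      \<open>sup_norm f + e\<close>.\<close>
    show "y \<le> sup_norm f"
    proof (rule field_le_epsilon)
      fix e :: real assume "0 < e"
      then show "y \<le> sup_norm f + e" using y[of "sup_norm f + e"] nn by simp
    qed
  qed auto
qed

end
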